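(* Let $E$ be a separable complex Hilbert space and let $X \in \mathcal{B}(H^2_E(\mathbb{D}))$. Let $$M^{S_E}_{S_E^*}(X) = \begin{bmatrix} S_E & X \\ 0 & S_E^* \end{bmatrix} : H^2_E(\mathbb{D}) \oplus H^2_E(\mathbb{D}) \to H^2_E(\mathbb{D}) \oplus H^2_E(\mathbb{D}).$$ Then the following are equivalent: (1) $M^{S_E}_{S_E^*}(X)$ is similar to a contraction. (2) There exist $A \in \mathcal{B}(H^2_E(\mathbb{D}))$ and $\Psi \in H^\infty_{\mathcal{B}(E)}(\mathbb{D})$ such that $$A^* P_E = \Psi P_E \quad\text{and}\quad X = A - S_E^* A S_E^*.$$ (3) There exist $A \in \mathcal{B}(H^2_E(\mathbb{D}))$ and $\Psi \in H^\infty_{\mathcal{B}(E)}(\mathbb{D})$ such that $$A P_E = X P_E, \quad A^* P_E = \Psi P_E, \quad\text{and}\quad X S_E = A S_E - S_E^* A.$$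
   Context: $\mathcal{B}(H)$ denotes the bounded linear operators on a Hilbert space $H$. An operator $T \in \mathcal{B}(H)$ is a contraction if $\|T\| \le 1$, and is similar to a contraction if there is an invertible $W \in \mathcal{B}(H)$ such that $W^{-1} T W$ is a contraction. $\mathbb{D}$ is the open unit disc in $\mathbb{C}$. $H^2_E(\mathbb{D})$ is the $E$-valued Hardy space over $\mathbb{D}$, and $S_E$ is the shift on it, $(S_E f)(z) = z f(z)$. $E$ is viewed as the closed subspace of constant functions in $H^2_E(\mathbb{D})$, and $P_E$ is the orthogonal projection of $H^2_E(\mathbb{D})$ onto $E$. $H^\infty_{\mathcal{B}(E)}(\mathbb{D})$ is the space of $\mathcal{B}(E)$-valued bounded analytic functions on $\mathbb{D}$. For $\Psi \in H^\infty_{\mathcal{B}(E)}(\mathbb{D})$, $\Psi P_E$ denotes the operator $f \mapsto \Psi \cdot (P_E f)$ on $H^2_E(\mathbb{D})$ (multiplication by $\Psi$ after projecting onto $E$); thus $A^* P_E = \Psi P_E$ means $(A^* e)(z) = \Psi(z) e$ for all $e \in E$, $z\in\mathbb{D}$. *)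

theory Defs
  imports "HOL-Analysis.Analysis"
begin

section \<open>Complex Hilbert spaces\<close>

text \<open>
  A complex inner product space is presented as a real one (which supplies norm and topology)
  together with a compatible complex scalar multiplication and a sesquilinear form, linear in its
  first argument, whose real part is the real inner product.  Positive definiteness of
  \<^term>\<open>cinner\<close> and \<open>norm x ^ 2 = cinner x x\<close> are consequences, see
  \<open>cinner_self\<close> below.
\<close>

class scaleC =
  fixes scaleC :: "complex \<Rightarrow> 'a \<Rightarrow> 'a" (infixr "*\<^sub>C" 75)

class complex_inner = real_inner + scaleC +
  fixes cinner :: "'a \<Rightarrow> 'a \<Rightarrow> complex"
  assumes scaleC_add_right: "c *\<^sub>C (x + y) = c *\<^sub>C x + c *\<^sub>C y"
    and scaleC_add_left: "(c + d) *\<^sub>C x = c *\<^sub>C x + d *\<^sub>C x"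
    and scaleC_scaleC: "c *\<^sub>C d *\<^sub>C x = (c * d) *\<^sub>C x"
    and scaleC_of_real: "complex_of_real r *\<^sub>C x = r *\<^sub>R x"
    and cinner_commute: "cinner x y = cnj (cinner y x)"
    and cinner_add_left: "cinner (x + y) z = cinner x z + cinner y z"
    and cinner_scaleC_left: "cinner (c *\<^sub>C x) y = c * cinner x y"
    and Re_cinner: "Re (cinner x y) = inner x y"

class chilbert_space = complex_inner + complete_space

subclass (in chilbert_space) banach ..

lemma scaleC_one [simp]:
  fixes x :: "'a::complex_inner"
  shows "1 *\<^sub>C x = x"
  using scaleC_of_real[of 1 x] by simp

lemma scaleC_zero_left [simp]:
  fixes x :: "'a::complex_inner"
  shows "0 *\<^sub>C x = 0"
  using scaleC_of_real[of 0 x] by simp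

lemma scaleC_zero_right [simp]:
  shows "c *\<^sub>C (0 :: 'a::complex_inner) = 0"
  using scaleC_add_right[of c 0 "0 :: 'a"] by simp

lemma scaleC_minus_right:
  fixes x :: "'a::complex_inner"
  shows "c *\<^sub>C (- x) = - (c *\<^sub>C x)"
  using scaleC_add_right[of c x "- x"] by (simp add: eq_neg_iff_add_eq_0 add.commute)

lemma scaleC_diff_right:
  fixes x y :: "'a::complex_inner"
  shows "c *\<^sub>C (x - y) = c *\<^sub>C x - c *\<^sub>C y"
  using scaleC_add_right[of c x "- y"] by (simp add: scaleC_minus_right)

lemma cinner_zero_left [simp]:
  fixes y :: "'a::complex_inner"
  shows "cinner 0 y = 0"
  using cinner_add_left[of 0 0 y] by simp

lemma cinner_minus_left:
  fixes x y :: "'a::complex_inner"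
  shows "cinner (- x) y = - cinner x y"
  using cinner_add_left[of x "- x" y] by (simp add: eq_neg_iff_add_eq_0 add.commute)

lemma cinner_diff_left:
  fixes x y z :: "'a::complex_inner"
  shows "cinner (x - y) z = cinner x z - cinner y z"
  using cinner_add_left[of x "- y" z] by (simp add: cinner_minus_left)

lemma cinner_zero_right [simp]:
  fixes x :: "'a::complex_inner"
  shows "cinner x 0 = 0"
  using cinner_commute[of x 0] by simp

lemma cinner_add_right:
  fixes x y z :: "'a::complex_inner"
  shows "cinner x (y + z) = cinner x y + cinner x z"
  by (metis cinner_add_left cinner_commute complex_cnj_add)

lemma cinner_diff_right:
  fixes x y z :: "'a::complex_inner"
  shows "cinner x (y - z) = cinner x y - cinner x z"
  by (metis cinner_diff_left cinner_commute complex_cnj_diff)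

lemma cinner_scaleC_right:
  fixes x y :: "'a::complex_inner"
  shows "cinner x (c *\<^sub>C y) = cnj c * cinner x y"
  by (metis cinner_scaleC_left cinner_commute complex_cnj_mult complex_cnj_cnj)

lemma cinner_self:
  fixes x :: "'a::complex_inner"
  shows "cinner x x = complex_of_real ((norm x)\<^sup>2)"
proof (rule complex_eqI)
  show "Re (cinner x x) = Re (complex_of_real ((norm x)\<^sup>2))"
    by (simp add: Re_cinner norm_eq_sqrt_inner)
  have "cinner x x = cnj (cinner x x)" by (rule cinner_commute)
  then show "Im (cinner x x) = Im (complex_of_real ((norm x)\<^sup>2))"
    by (metis Im_complex_of_real cnj.simps(2) equal_neg_zero)
qed

lemma norm_scaleC:
  fixes x :: "'a::complex_inner"
  shows "norm (c *\<^sub>C x) = cmod c * norm x"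
proof -
  have "complex_of_real ((norm (c *\<^sub>C x))\<^sup>2) = complex_of_real ((cmod c * norm x)\<^sup>2)"
    unfolding cinner_self[symmetric] cinner_scaleC_left cinner_scaleC_right
    by (simp add: cinner_self power_mult_distrib mult_ac flip: complex_norm_square)
  then have "(norm (c *\<^sub>C x))\<^sup>2 = (cmod c * norm x)\<^sup>2"
    by (simp only: of_real_eq_iff)
  moreover have "0 \<le> norm (c *\<^sub>C x)" "0 \<le> norm x"
    by (simp_all add: norm_eq_sqrt_inner)
  ultimately show ?thesis by (simp add: power2_eq_iff_nonneg)
qed

lemma norm_cinner_le: "cmod (cinner x y) \<le> norm x * norm y"
proof -
  define w where "w = cinner x y"
  show ?thesis
  proof (cases "w = 0")
    case False
    define c where "c = cnj (sgn w)"
    have c: "cmod c = 1" using False by (simp add: c_def norm_sgn)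
    have "c * w = complex_of_real (cmod w)"
      using False by (simp add: c_def sgn_eq field_simps flip: complex_norm_square)
        (simp add: power2_eq_square)
    then have "cmod w = Re (cinner (c *\<^sub>C x) y)" by (simp add: cinner_scaleC_left w_def)
    also have "\<dots> \<le> norm (c *\<^sub>C x) * norm y" by (simp add: Re_cinner norm_cauchy_schwarz)
    finally show ?thesis using c by (simp add: norm_scaleC w_def)
  qed (simp flip: w_def)
qed

instantiation complex :: chilbert_space
begin
definition scaleC_complex :: "complex \<Rightarrow> complex \<Rightarrow> complex" where "scaleC_complex c x = c * x"
definition cinner_complex :: "complex \<Rightarrow> complex \<Rightarrow> complex" where "cinner_complex x y = x * cnj y"
instance
  by standard (auto simp: scaleC_complex_def cinner_complex_def algebra_simps scaleR_conv_of_real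
      inner_complex_def)
end

text \<open>The Hilbert space direct sum \<open>H \<oplus> K\<close> is the product type.\<close>

instantiation prod :: (complex_inner, complex_inner) complex_inner
begin
definition scaleC_prod :: "complex \<Rightarrow> 'a \<times> 'b \<Rightarrow> 'a \<times> 'b"
  where "scaleC_prod c x = (c *\<^sub>C fst x, c *\<^sub>C snd x)"
definition cinner_prod :: "'a \<times> 'b \<Rightarrow> 'a \<times> 'b \<Rightarrow> complex"
  where "cinner_prod x y = cinner (fst x) (fst y) + cinner (snd x) (snd y)"
instance
proof
  fix x y :: "'a \<times> 'b"
  show "cinner x y = cnj (cinner y x)"
    unfolding cinner_prod_def by (metis cinner_commute complex_cnj_add)
qed (auto simp: scaleC_prod_def cinner_prod_def scaleC_add_left scaleC_add_right scaleC_scaleC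
      scaleC_of_real cinner_add_left cinner_scaleC_left algebra_simps Re_cinner inner_prod_def
      scaleR_prod_def)
end

instance prod :: (chilbert_space, chilbert_space) chilbert_space ..

section \<open>Bounded operators\<close>

definition bounded_clinear :: "('a::complex_inner \<Rightarrow> 'b::complex_inner) \<Rightarrow> bool"
  where "bounded_clinear T \<longleftrightarrow> bounded_linear T \<and> (\<forall>c x. T (c *\<^sub>C x) = c *\<^sub>C T x)"

definition contraction :: "('a::complex_inner \<Rightarrow> 'a) \<Rightarrow> bool"
  where "contraction T \<longleftrightarrow> bounded_clinear T \<and> onorm T \<le> 1"

definition similar_to_contraction :: "('a::complex_inner \<Rightarrow> 'a) \<Rightarrow> bool"
  where "similar_to_contraction T \<longleftrightarrow>
    (\<exists>W V :: 'a \<Rightarrow> 'a. bounded_clinear W \<and> bounded_clinear V \<and> V \<circ> W = id \<and> W \<circ> V = id \<and>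
           contraction (V \<circ> T \<circ> W))"

text \<open>For a bounded operator between Hilbert spaces the adjoint exists by the Riesz representation
  theorem; uniqueness is \<open>cadjoint_eqI\<close>.\<close>

definition cadjoint :: "('a::complex_inner \<Rightarrow> 'b::complex_inner) \<Rightarrow> 'b \<Rightarrow> 'a"
  where "cadjoint T = (THE S. \<forall>x y. cinner (T x) y = cinner x (S y))"

lemma cinner_eqI:
  fixes x y :: "'a::complex_inner"
  assumes "\<And>z. cinner z x = cinner z y"
  shows "x = y"
proof -
  have "cinner (x - y) (x - y) = 0" by (simp add: cinner_diff_right assms)
  then show ?thesis by (simp add: cinner_self)
qed

lemma cadjoint_eqI:
  assumes "\<And>x y. cinner (T x) y = cinner x (S y)"
  shows "cadjoint T = S"
  unfolding cadjoint_def
proof (rule the_equality)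
  fix R assume R: "\<forall>x y. cinner (T x) y = cinner x (R y)"
  show "R = S" by (rule ext, rule cinner_eqI) (simp add: R[rule_format, symmetric] assms[symmetric])
qed (simp add: assms)

definition orth_proj :: "'a::complex_inner set \<Rightarrow> 'a \<Rightarrow> 'a"
  where "orth_proj M x = (THE p. p \<in> M \<and> (\<forall>m\<in>M. cinner (x - p) m = 0))"

definition upper_block ::
  "('a::plus \<Rightarrow> 'a) \<Rightarrow> ('b \<Rightarrow> 'a) \<Rightarrow> ('b \<Rightarrow> 'b) \<Rightarrow> 'a \<times> 'b \<Rightarrow> 'a \<times> 'b"
  where "upper_block A X B = (\<lambda>(f, g). (A f + X g, B g))"

section \<open>The vector-valued Hardy space\<close>

text \<open>
  Elements are the functions on the open unit disc with a power series expansion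
  \<open>f(z) = (\<Sum>n. z ^ n a n)\<close>, \<open>(\<Sum>n. norm (a n) ^ 2) < \<infinity>\<close>, and the inner product is
  that of the coefficient sequences.  To have extensional equality the functions are totalised
  by \<open>0\<close> outside the disc.
\<close>

definition sq_summable :: "(nat \<Rightarrow> 'e::chilbert_space) \<Rightarrow> bool"
  where "sq_summable a \<longleftrightarrow> summable (\<lambda>n. (norm (a n))\<^sup>2)"

definition disc_series :: "(nat \<Rightarrow> 'e::chilbert_space) \<Rightarrow> complex \<Rightarrow> 'e"
  where "disc_series a z = (if z \<in> ball 0 1 then \<Sum>n. z ^ n *\<^sub>C a n else 0)"

typedef (overloaded) 'e hardy = "{disc_series a | a :: nat \<Rightarrow> 'e::chilbert_space. sq_summable a}"
  morphisms hardy_eval Abs_hardy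
proof -
  have "sq_summable (\<lambda>n. 0 :: 'e)" by (simp add: sq_summable_def)
  then show ?thesis by blast
qed

definition hardy_coeff :: "'e::chilbert_space hardy \<Rightarrow> nat \<Rightarrow> 'e"
  where "hardy_coeff f = (THE a. sq_summable a \<and> hardy_eval f = disc_series a)"

lemma sq_summable_add:
  assumes "sq_summable a" "sq_summable b"
  shows "sq_summable (\<lambda>n. a n + b n)"
proof -
  have "norm ((norm (a n + b n))\<^sup>2) \<le> 2 * (norm (a n))\<^sup>2 + 2 * (norm (b n))\<^sup>2" for n
  proof -
    have "(norm (a n + b n))\<^sup>2 \<le> (norm (a n) + norm (b n))\<^sup>2"
      by (intro power_mono norm_triangle_ineq) auto
    also have "\<dots> \<le> 2 * (norm (a n))\<^sup>2 + 2 * (norm (b n))\<^sup>2"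
      using sum_squares_bound[of "norm (a n)" "norm (b n)"] by (simp add: power2_sum)
    finally show ?thesis by simp
  qed
  moreover have "summable (\<lambda>n. 2 * (norm (a n))\<^sup>2 + 2 * (norm (b n))\<^sup>2)"
    using assms unfolding sq_summable_def by (intro summable_add summable_mult)
  ultimately show ?thesis unfolding sq_summable_def by (blast intro: summable_comparison_test')
qed

lemma sq_summable_scaleC: "sq_summable a \<Longrightarrow> sq_summable (\<lambda>n. c *\<^sub>C a n)"
  by (auto simp: sq_summable_def norm_scaleC power_mult_distrib intro: summable_mult)

lemma sq_summable_minus: "sq_summable a \<Longrightarrow> sq_summable (\<lambda>n. - a n)"
  by (simp add: sq_summable_def)

lemma sq_summable_diff: "sq_summable a \<Longrightarrow> sq_summable b \<Longrightarrow> sq_summable (\<lambda>n. a n - b n)"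
  using sq_summable_add[OF _ sq_summable_minus, of a b] by simp

lemma sq_summable_finite: "sq_summable (\<lambda>n. if n = 0 then e else 0)"
  unfolding sq_summable_def by (rule summable_finite[of "{0}"]) auto

lemma summable_norm_disc:
  assumes "sq_summable a" "z \<in> ball 0 1"
  shows "summable (\<lambda>n. norm (z ^ n *\<^sub>C a n))"
proof -
  have "(norm (a n))\<^sup>2 \<le> (\<Sum>n. (norm (a n))\<^sup>2)" for n
    using sum_le_suminf[of "\<lambda>n. (norm (a n))\<^sup>2" "{n}"] assms(1) by (simp add: sq_summable_def)
  then have *: "norm (a n) \<le> sqrt (\<Sum>n. (norm (a n))\<^sup>2)" for n
    by (simp add: real_le_rsqrt)
  have "summable (\<lambda>n. cmod z ^ n * sqrt (\<Sum>n. (norm (a n))\<^sup>2))"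
    using assms(2) by (intro summable_mult2 summable_geometric) auto
  then show ?thesis
    by (rule summable_comparison_test'[where N = 0])
      (auto simp: norm_scaleC norm_power intro!: mult_left_mono *)
qed

lemma summable_disc: "sq_summable a \<Longrightarrow> z \<in> ball 0 1 \<Longrightarrow> summable (\<lambda>n. z ^ n *\<^sub>C a n)"
  by (rule summable_norm_cancel[OF summable_norm_disc])

lemma bounded_linear_scaleC: "bounded_linear (\<lambda>x::'a::complex_inner. c *\<^sub>C x)"
proof (rule bounded_linear_intro[where K = "cmod c"])
  show "c *\<^sub>C (r *\<^sub>R x) = r *\<^sub>R (c *\<^sub>C x)" for r and x :: 'a
    by (simp flip: scaleC_of_real add: scaleC_scaleC mult.commute)
qed (auto simp: scaleC_add_right norm_scaleC mult.commute)

lemma bounded_linear_cinner_left: "bounded_linear (\<lambda>x::'a::complex_inner. cinner x y)"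
proof (rule bounded_linear_intro[where K = "norm y"])
  show "cinner (r *\<^sub>R x) y = r *\<^sub>R cinner x y" for r and x :: 'a
    by (metis cinner_scaleC_left scaleC_of_real scaleR_conv_of_real)
qed (auto simp: cinner_add_left norm_cinner_le)

lemma disc_series_add:
  "sq_summable a \<Longrightarrow> sq_summable b \<Longrightarrow>
    disc_series (\<lambda>n. a n + b n) z = disc_series a z + disc_series b z"
  by (auto simp: disc_series_def scaleC_add_right intro!: suminf_add[symmetric] summable_disc)

lemma disc_series_scaleC:
  assumes "sq_summable a"
  shows "disc_series (\<lambda>n. c *\<^sub>C a n) z = c *\<^sub>C disc_series a z"
proof (cases "z \<in> ball 0 1")
  case True
  have "c *\<^sub>C (\<Sum>n. z ^ n *\<^sub>C a n) = (\<Sum>n. c *\<^sub>C (z ^ n *\<^sub>C a n))"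
    using summable_disc[OF assms True] by (rule bounded_linear.suminf[OF bounded_linear_scaleC])
  then show ?thesis using True by (simp add: disc_series_def scaleC_scaleC mult.commute)
qed (auto simp: disc_series_def)

lemma disc_series_minus: "disc_series (\<lambda>n. - a n) z = - disc_series a z" if "sq_summable a"
proof -
  have *: "(-1) *\<^sub>C x = - x" for x :: 'a
    using scaleC_of_real[of "-1" x] by simp
  show ?thesis using disc_series_scaleC[OF that, of "-1" z] by (simp only: *)
qed

lemma disc_series_diff:
  "sq_summable a \<Longrightarrow> sq_summable b \<Longrightarrow>
    disc_series (\<lambda>n. a n - b n) z = disc_series a z - disc_series b z"
  using disc_series_add[OF _ sq_summable_minus, of a b z] by (simp add: disc_series_minus)

lemma disc_series_inj:
  fixes a b :: "nat \<Rightarrow> 'e::chilbert_space"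
  assumes "sq_summable a" "sq_summable b" and eq: "disc_series a = disc_series b"
  shows "a = b"
proof (rule ccontr)
  define d where "d n = a n - b n" for n
  have d: "sq_summable d" unfolding d_def using assms by (intro sq_summable_diff)
  assume "a \<noteq> b"
  then obtain m where m: "d m \<noteq> 0" by (auto simp: d_def fun_eq_iff)
  define c where "c n = cinner (d n) (d m)" for n
  have cm: "c m \<noteq> 0" using m by (simp add: c_def cinner_self)
  have zero: "(\<lambda>n. c n * z ^ n) sums 0" if z: "norm z < 1" for z
  proof -
    have zb: "z \<in> ball 0 1" using z by simp
    have "disc_series d z = 0"
      unfolding d_def using disc_series_diff[OF assms(1,2), of z] eq by simp
    then have "(\<lambda>n. z ^ n *\<^sub>C d n) sums 0"
      using summable_sums[OF summable_disc[OF d zb]] zb by (simp add: disc_series_def)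
    from bounded_linear.sums[OF bounded_linear_cinner_left this, of "d m"]
    show ?thesis by (simp add: cinner_scaleC_left c_def mult.commute)
  qed
  define k where "k = (LEAST n. c n \<noteq> 0)"
  have k: "c k \<noteq> 0" unfolding k_def using cm by (rule LeastI)
  have less: "c n = 0" if "n < k" for n using that not_less_Least unfolding k_def by blast
  have "(\<lambda>n. c (n + k) * z ^ n) sums 0" if z: "z \<noteq> 0" "norm z < 1" for z
  proof -
    have "(\<lambda>n. c (n + k) * z ^ (n + k)) sums 0"
      using sums_split_initial_segment[OF zero[OF z(2)], of k] less by simp
    from sums_mult[OF this, of "inverse (z ^ k)"] show ?thesis
      using z(1) by (simp add: power_add field_simps)
  qed
  then have "((\<lambda>z::complex. 0::complex) \<longlongrightarrow> c (0 + k)) (at 0)"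
    by (intro powser_limit_0_strong[where s = 1 and a = "\<lambda>n. c (n + k)"]) auto
  then show False using k by (simp add: tendsto_const_iff)
qed

lemma hardy_coeff_unique:
  assumes "sq_summable a" "hardy_eval f = disc_series a"
  shows "hardy_coeff f = a"
  unfolding hardy_coeff_def using assms disc_series_inj by (intro the_equality) auto

lemma hardy_coeff: "sq_summable (hardy_coeff f)" "hardy_eval f = disc_series (hardy_coeff f)"
proof -
  obtain a where "sq_summable a" "hardy_eval f = disc_series a" using hardy_eval[of f] by auto
  with hardy_coeff_unique[of a f]
  show "sq_summable (hardy_coeff f)" "hardy_eval f = disc_series (hardy_coeff f)" by auto
qed

lemma hardy_coeff_inject: "hardy_coeff f = hardy_coeff g \<longleftrightarrow> f = g"
  using hardy_coeff(2)[of f] hardy_coeff(2)[of g] hardy_eval_inject[of f g] by auto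

lemma hardy_exists: "sq_summable a \<Longrightarrow> \<exists>f. hardy_coeff f = a"
  by (rule exI[of _ "Abs_hardy (disc_series a)"], rule hardy_coeff_unique)
    (auto intro!: Abs_hardy_inverse)

lemma hardy_eval_Abs:
  "sq_summable a \<Longrightarrow> F = disc_series a \<Longrightarrow> hardy_eval (Abs_hardy F) = F"
  by (auto intro!: Abs_hardy_inverse)

lemma hardy_coeff_Abs:
  "sq_summable a \<Longrightarrow> F = disc_series a \<Longrightarrow> hardy_coeff (Abs_hardy F) = a"
  by (intro hardy_coeff_unique) (auto simp: hardy_eval_Abs)

instantiation hardy :: (chilbert_space) complex_inner
begin

definition zero_hardy :: "'a hardy" where "0 = Abs_hardy (\<lambda>z. 0)"
definition plus_hardy :: "'a hardy \<Rightarrow> 'a hardy \<Rightarrow> 'a hardy"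
  where "f + g = Abs_hardy (\<lambda>z. hardy_eval f z + hardy_eval g z)"
definition uminus_hardy :: "'a hardy \<Rightarrow> 'a hardy"
  where "- f = Abs_hardy (\<lambda>z. - hardy_eval f z)"
definition minus_hardy :: "'a hardy \<Rightarrow> 'a hardy \<Rightarrow> 'a hardy"
  where "f - g = Abs_hardy (\<lambda>z. hardy_eval f z - hardy_eval g z)"
definition scaleC_hardy :: "complex \<Rightarrow> 'a hardy \<Rightarrow> 'a hardy"
  where "c *\<^sub>C f = Abs_hardy (\<lambda>z. c *\<^sub>C hardy_eval f z)"
definition scaleR_hardy :: "real \<Rightarrow> 'a hardy \<Rightarrow> 'a hardy"
  where "r *\<^sub>R f = complex_of_real r *\<^sub>C f" for f :: "'a hardy"
definition cinner_hardy :: "'a hardy \<Rightarrow> 'a hardy \<Rightarrow> complex"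
  where "cinner f g = (\<Sum>n. cinner (hardy_coeff f n) (hardy_coeff g n))"
definition inner_hardy :: "'a hardy \<Rightarrow> 'a hardy \<Rightarrow> real"
  where "inner f g = Re (cinner f g)" for f :: "'a hardy"
definition norm_hardy :: "'a hardy \<Rightarrow> real"
  where "norm f = sqrt (inner f f)" for f :: "'a hardy"
definition dist_hardy :: "'a hardy \<Rightarrow> 'a hardy \<Rightarrow> real"
  where "dist f g = norm (f - g)" for f :: "'a hardy"
definition sgn_hardy :: "'a hardy \<Rightarrow> 'a hardy"
  where "sgn f = inverse (norm f) *\<^sub>R f" for f :: "'a hardy"
definition uniformity_hardy :: "('a hardy \<times> 'a hardy) filter"
  where "uniformity = (INF e\<in>{0 <..}. principal {(f, g :: 'a hardy). dist f g < e})"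
definition open_hardy :: "'a hardy set \<Rightarrow> bool"
  where "open U = (\<forall>f\<in>U. \<forall>\<^sub>F (f', g) in uniformity. f' = f \<longrightarrow> g \<in> U)"
    for U :: "'a hardy set"

lemma hardy_coeff_ops:
  fixes f g :: "'a hardy"
  shows "hardy_coeff (0 :: 'a hardy) = (\<lambda>n. 0)"
    and "hardy_coeff (f + g) = (\<lambda>n. hardy_coeff f n + hardy_coeff g n)"
    and "hardy_coeff (- f) = (\<lambda>n. - hardy_coeff f n)"
    and "hardy_coeff (f - g) = (\<lambda>n. hardy_coeff f n - hardy_coeff g n)"
    and "hardy_coeff (c *\<^sub>C f) = (\<lambda>n. c *\<^sub>C hardy_coeff f n)"
    and "hardy_coeff (r *\<^sub>R f) = (\<lambda>n. r *\<^sub>R hardy_coeff f n)"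
proof -
  note sq = hardy_coeff(1) and ev = hardy_coeff(2)
  show "hardy_coeff (0 :: 'a hardy) = (\<lambda>n. 0)"
    unfolding zero_hardy_def
    by (rule hardy_coeff_Abs) (auto simp: sq_summable_def disc_series_def)
  show "hardy_coeff (f + g) = (\<lambda>n. hardy_coeff f n + hardy_coeff g n)"
    unfolding plus_hardy_def by (rule hardy_coeff_Abs)
      (auto simp: disc_series_add[OF sq sq] ev intro!: sq_summable_add sq)
  show "hardy_coeff (- f) = (\<lambda>n. - hardy_coeff f n)"
    unfolding uminus_hardy_def by (rule hardy_coeff_Abs)
      (auto simp: disc_series_minus[OF sq] ev intro!: sq_summable_minus sq)
  show "hardy_coeff (f - g) = (\<lambda>n. hardy_coeff f n - hardy_coeff g n)"
    unfolding minus_hardy_def by (rule hardy_coeff_Abs)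
      (auto simp: disc_series_diff[OF sq sq] ev intro!: sq_summable_diff sq)
  show C: "hardy_coeff (c *\<^sub>C f) = (\<lambda>n. c *\<^sub>C hardy_coeff f n)" for c
    unfolding scaleC_hardy_def by (rule hardy_coeff_Abs)
      (auto simp: disc_series_scaleC[OF sq] ev intro!: sq_summable_scaleC sq)
  show "hardy_coeff (r *\<^sub>R f) = (\<lambda>n. r *\<^sub>R hardy_coeff f n)"
    unfolding scaleR_hardy_def C by (simp add: scaleC_of_real)
qed

lemma summable_cinner:
  "summable (\<lambda>n. cinner (hardy_coeff f n) (hardy_coeff g n))" for f g :: "'a hardy"
proof (rule summable_comparison_test'[where N = 0])
  show "summable (\<lambda>n. (norm (hardy_coeff f n))\<^sup>2 + (norm (hardy_coeff g n))\<^sup>2)"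
    using hardy_coeff(1) unfolding sq_summable_def by (intro summable_add) auto
  fix n
  have "norm (cinner (hardy_coeff f n) (hardy_coeff g n))
      \<le> norm (hardy_coeff f n) * norm (hardy_coeff g n)"
    by (rule norm_cinner_le)
  also have "\<dots> \<le> (norm (hardy_coeff f n))\<^sup>2 + (norm (hardy_coeff g n))\<^sup>2"
    using sum_squares_bound[of "norm (hardy_coeff f n)" "norm (hardy_coeff g n)"]
      mult_nonneg_nonneg[of "norm (hardy_coeff f n)" "norm (hardy_coeff g n)"]
    unfolding mult.assoc by (simp del: zero_le_mult_iff mult_nonneg_nonneg)
  finally show "norm (cinner (hardy_coeff f n) (hardy_coeff g n))
      \<le> (norm (hardy_coeff f n))\<^sup>2 + (norm (hardy_coeff g n))\<^sup>2" .
qed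

lemma inner_hardy_self: "inner f f = (\<Sum>n. (norm (hardy_coeff f n))\<^sup>2)" for f :: "'a hardy"
  unfolding inner_hardy_def cinner_hardy_def
  by (subst bounded_linear.suminf[OF bounded_linear_Re summable_cinner])
    (simp add: cinner_self del: of_real_power)

instance
proof
  fix f g h :: "'a hardy" and c d :: complex and r s :: real
  note eqI = iffD1[OF hardy_coeff_inject]
  note ops = hardy_coeff_ops
  show "f + g + h = f + (g + h)" "f + g = g + f" "0 + f = f" "- f + f = 0" "f - g = f + - g"
    by (auto intro!: eqI simp: ops algebra_simps)
  show "r *\<^sub>R (f + g) = r *\<^sub>R f + r *\<^sub>R g" "(r + s) *\<^sub>R f = r *\<^sub>R f + s *\<^sub>R f"
    "r *\<^sub>R s *\<^sub>R f = (r * s) *\<^sub>R f" "1 *\<^sub>R f = f"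
    by (auto intro!: eqI simp: ops algebra_simps)
  show "c *\<^sub>C (f + g) = c *\<^sub>C f + c *\<^sub>C g" "(c + d) *\<^sub>C f = c *\<^sub>C f + d *\<^sub>C f"
    "c *\<^sub>C d *\<^sub>C f = (c * d) *\<^sub>C f"
    by (auto intro!: eqI simp: ops scaleC_add_left scaleC_add_right scaleC_scaleC)
  show "complex_of_real r *\<^sub>C f = r *\<^sub>R f" by (simp add: scaleR_hardy_def)
  show comm: "cinner f g = cnj (cinner g f)" for f g :: "'a hardy"
  proof -
    have "cnj (cinner g f) = (\<Sum>n. cnj (cinner (hardy_coeff g n) (hardy_coeff f n)))"
      unfolding cinner_hardy_def
      by (rule bounded_linear.suminf[OF bounded_linear_cnj summable_cinner])
    also have "\<dots> = cinner f g"
      unfolding cinner_hardy_def by (simp only: cinner_commute[symmetric])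
    finally show ?thesis by simp
  qed
  show add: "cinner (f + g) h = cinner f h + cinner g h"
    unfolding cinner_hardy_def
    by (simp add: ops cinner_add_left suminf_add[OF summable_cinner summable_cinner])
  show scale: "cinner (c *\<^sub>C f) g = c * cinner f g" for c
    unfolding cinner_hardy_def by (simp add: ops cinner_scaleC_left suminf_mult[OF summable_cinner])
  show "Re (cinner f g) = inner f g" by (simp add: inner_hardy_def)
  show "inner f g = inner g f" unfolding inner_hardy_def by (subst comm) simp
  show "inner (f + g) h = inner f h + inner g h" by (simp add: inner_hardy_def add)
  show "inner (r *\<^sub>R f) g = r * inner f g" by (simp add: inner_hardy_def scaleR_hardy_def scale)
  have sm: "summable (\<lambda>n. (norm (hardy_coeff f n))\<^sup>2)"
    using hardy_coeff(1)[of f] by (simp add: sq_summable_def)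
  show "0 \<le> inner f f" unfolding inner_hardy_self by (rule suminf_nonneg[OF sm]) auto
  show "inner f f = 0 \<longleftrightarrow> f = 0"
    unfolding inner_hardy_self
    by (auto simp: suminf_eq_zero_iff[OF sm] ops hardy_coeff_inject[symmetric] fun_eq_iff)
  show "norm f = sqrt (inner f f)" by (rule norm_hardy_def)
  show "dist f g = norm (f - g)" by (rule dist_hardy_def)
  show "sgn f = inverse (norm f) *\<^sub>R f" by (rule sgn_hardy_def)
  show "uniformity = (INF e\<in>{0 <..}. principal {(f, g :: 'a hardy). dist f g < e})"
    by (rule uniformity_hardy_def)
  show "open U = (\<forall>f\<in>U. \<forall>\<^sub>F (f', g) in uniformity. f' = f \<longrightarrow> g \<in> U)"
    for U :: "'a hardy set"
    by (rule open_hardy_def)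
qed

end

lemma norm_hardy_square: "(norm f)\<^sup>2 = (\<Sum>n. (norm (hardy_coeff f n))\<^sup>2)"
  for f :: "'a::chilbert_space hardy"
  by (simp only: inner_hardy_self[symmetric] power2_norm_eq_inner[of f])

lemma sum_hardy_coeff_le: "(\<Sum>n<m. (norm (hardy_coeff f n))\<^sup>2) \<le> (norm f)\<^sup>2"
  for f :: "'a::chilbert_space hardy"
  unfolding norm_hardy_square
  using hardy_coeff(1)[of f] by (intro sum_le_suminf) (auto simp: sq_summable_def)

lemma norm_hardy_coeff_le: "norm (hardy_coeff f n) \<le> norm f"
  for f :: "'a::chilbert_space hardy"
proof -
  have "(norm (hardy_coeff f n))\<^sup>2 \<le> (\<Sum>k<Suc n. (norm (hardy_coeff f k))\<^sup>2)"
    by (intro member_le_sum) auto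
  also have "\<dots> \<le> (norm f)\<^sup>2" by (rule sum_hardy_coeff_le)
  finally show ?thesis by (rule power2_le_imp_le) simp
qed

instance hardy :: (chilbert_space) chilbert_space
proof
  fix F :: "nat \<Rightarrow> 'a hardy"
  assume F: "Cauchy F"
  have "Cauchy (\<lambda>k. hardy_coeff (F k) n)" for n
  proof (rule metric_CauchyI)
    fix e :: real assume "e > 0"
    then obtain M where M: "\<And>k l. k \<ge> M \<Longrightarrow> l \<ge> M \<Longrightarrow> dist (F k) (F l) < e"
      using metric_CauchyD[OF F] by blast
    have "dist (hardy_coeff (F k) n) (hardy_coeff (F l) n) \<le> dist (F k) (F l)" for k l
      using norm_hardy_coeff_le[of "F k - F l" n] by (simp add: dist_norm hardy_coeff_ops)
    then show "\<exists>M. \<forall>k\<ge>M. \<forall>l\<ge>M. dist (hardy_coeff (F k) n) (hardy_coeff (F l) n) < e"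
      using M by (meson le_less_trans)
  qed
  then have "\<exists>x. (\<lambda>k. hardy_coeff (F k) n) \<longlonglongrightarrow> x" for n
    by (simp add: Cauchy_convergent_iff convergent_def)
  then obtain a where a: "\<And>n. (\<lambda>k. hardy_coeff (F k) n) \<longlonglongrightarrow> a n" by metis
  have bound: "(\<Sum>n<m. (norm (hardy_coeff (F k) n - a n))\<^sup>2) \<le> e\<^sup>2"
    if near: "\<And>l. l \<ge> M \<Longrightarrow> dist (F k) (F l) < e" for k m M e
  proof (rule LIMSEQ_le_const2)
    show "(\<lambda>l. \<Sum>n<m. (norm (hardy_coeff (F k) n - hardy_coeff (F l) n))\<^sup>2)
        \<longlonglongrightarrow> (\<Sum>n<m. (norm (hardy_coeff (F k) n - a n))\<^sup>2)"
      by (intro tendsto_intros a)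
    have "(\<Sum>n<m. (norm (hardy_coeff (F k) n - hardy_coeff (F l) n))\<^sup>2) \<le> e\<^sup>2" if l: "l \<ge> M" for l
    proof -
      have "(\<Sum>n<m. (norm (hardy_coeff (F k) n - hardy_coeff (F l) n))\<^sup>2) \<le> (norm (F k - F l))\<^sup>2"
        using sum_hardy_coeff_le[of "F k - F l" m] by (simp add: hardy_coeff_ops)
      also have "\<dots> \<le> e\<^sup>2" using near[OF l] by (intro power_mono) (auto simp: dist_norm)
      finally show ?thesis .
    qed
    then show "\<exists>N. \<forall>l\<ge>N. (\<Sum>n<m. (norm (hardy_coeff (F k) n - hardy_coeff (F l) n))\<^sup>2) \<le> e\<^sup>2"
      by blast
  qed
  have sq: "sq_summable (\<lambda>n. hardy_coeff (F k) n - a n)"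
    and le: "(\<Sum>n. (norm (hardy_coeff (F k) n - a n))\<^sup>2) \<le> e\<^sup>2"
    if "\<And>l. l \<ge> M \<Longrightarrow> dist (F k) (F l) < e" for k M e
  proof -
    have b: "(\<Sum>n<m. (norm (hardy_coeff (F k) n - a n))\<^sup>2) \<le> e\<^sup>2" for m
      using that by (rule bound)
    show s: "sq_summable (\<lambda>n. hardy_coeff (F k) n - a n)"
      unfolding sq_summable_def
    proof (rule bounded_imp_summable)
      show "(\<Sum>n\<le>m. (norm (hardy_coeff (F k) n - a n))\<^sup>2) \<le> e\<^sup>2" for m
        using b[of "Suc m"] by (simp add: lessThan_Suc_atMost)
    qed auto
    show "(\<Sum>n. (norm (hardy_coeff (F k) n - a n))\<^sup>2) \<le> e\<^sup>2"
      using s b unfolding sq_summable_def by (intro suminf_le_const) auto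
  qed
  obtain M where M: "\<And>k l. k \<ge> M \<Longrightarrow> l \<ge> M \<Longrightarrow> dist (F k) (F l) < 1"
    using metric_CauchyD[OF F, of 1] by auto
  have "sq_summable (\<lambda>n. hardy_coeff (F M) n - (hardy_coeff (F M) n - a n))"
    using M by (intro sq_summable_diff hardy_coeff(1) sq[of M]) auto
  then obtain f where f: "hardy_coeff f = a" using hardy_exists[of a] by auto
  have "F \<longlonglongrightarrow> f"
  proof (rule metric_LIMSEQ_I)
    fix e :: real assume e: "e > 0"
    then obtain N where N: "\<And>k l. k \<ge> N \<Longrightarrow> l \<ge> N \<Longrightarrow> dist (F k) (F l) < e / 2"
      using metric_CauchyD[OF F, of "e / 2"] by auto
    have "dist (F k) f < e" if "k \<ge> N" for k
    proof -
      have "(norm (F k - f))\<^sup>2 \<le> (e / 2)\<^sup>2"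
        using le[of N k "e / 2"] N[OF that] by (simp add: norm_hardy_square hardy_coeff_ops f)
      then have "norm (F k - f) \<le> e / 2"
        using e by (rule power2_le_imp_le[OF _ less_imp_le[OF half_gt_zero]])
      then show ?thesis using e by (simp add: dist_norm)
    qed
    then show "\<exists>N. \<forall>k\<ge>N. dist (F k) f < e" by blast
  qed
  then show "convergent F" by (auto simp: convergent_def)
qed

definition hardy_shift :: "'e::chilbert_space hardy \<Rightarrow> 'e hardy"
  where "hardy_shift f = Abs_hardy (\<lambda>z. z *\<^sub>C hardy_eval f z)"

definition hardy_const :: "'e::chilbert_space \<Rightarrow> 'e hardy"
  where "hardy_const e = Abs_hardy (\<lambda>z. if z \<in> ball 0 1 then e else 0)"

definition proj_const :: "'e::chilbert_space hardy \<Rightarrow> 'e hardy"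
  where "proj_const = orth_proj (range hardy_const)"

text \<open>\<open>H\<^sup>\<infinity>\<close> of operator-valued functions: analyticity on the disc is complex differentiability
  with respect to the operator norm.  Values outside the disc are irrelevant.\<close>

definition H_infinity :: "(complex \<Rightarrow> 'e::chilbert_space \<Rightarrow> 'e) set"
  where "H_infinity = {\<Psi>.
    (\<forall>z\<in>ball 0 1. bounded_clinear (\<Psi> z)) \<and>
    (\<exists>C. \<forall>z\<in>ball 0 1. onorm (\<Psi> z) \<le> C) \<and>
    (\<forall>z\<in>ball 0 1. \<exists>D. bounded_clinear D \<and>
      ((\<lambda>w. onorm (\<lambda>x. inverse (w - z) *\<^sub>C (\<Psi> w x - \<Psi> z x) - D x)) \<longlongrightarrow> 0) (at z))}"

lemma disc_series_shift:
  assumes "sq_summable a"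
  shows "disc_series (\<lambda>n. case n of 0 \<Rightarrow> 0 | Suc m \<Rightarrow> a m) z = z *\<^sub>C disc_series a z"
proof (cases "z \<in> ball 0 1")
  case True
  have "(\<lambda>n. z *\<^sub>C (z ^ n *\<^sub>C a n)) sums (z *\<^sub>C (\<Sum>n. z ^ n *\<^sub>C a n))"
    using summable_sums[OF summable_disc[OF assms True]]
    by (rule bounded_linear.sums[OF bounded_linear_scaleC])
  then have "(\<lambda>n. z ^ Suc n *\<^sub>C (case Suc n of 0 \<Rightarrow> 0 | Suc m \<Rightarrow> a m))
      sums (z *\<^sub>C (\<Sum>n. z ^ n *\<^sub>C a n))"
    by (simp add: scaleC_scaleC)
  from sums_Suc[OF this] show ?thesis using True
    by (simp add: disc_series_def sums_iff)
qed (auto simp: disc_series_def)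

lemma sq_summable_shift: "sq_summable a \<Longrightarrow> sq_summable (\<lambda>n. case n of 0 \<Rightarrow> 0 | Suc m \<Rightarrow> a m)"
  unfolding sq_summable_def by (subst summable_Suc_iff[symmetric]) simp

lemma hardy_eval_shift: "hardy_eval (hardy_shift f) z = z *\<^sub>C hardy_eval f z"
  unfolding hardy_shift_def
  by (subst hardy_eval_Abs[OF sq_summable_shift[OF hardy_coeff(1)[of f]]])
    (auto simp: disc_series_shift[OF hardy_coeff(1)] hardy_coeff(2))

lemma disc_series_const:
  "disc_series (\<lambda>n. if n = 0 then e else 0) z = (if z \<in> ball 0 1 then e else 0)"
proof -
  have "(\<lambda>n. z ^ n *\<^sub>C (if n = 0 then e else 0)) = (\<lambda>n. if n = 0 then e else 0)" by auto
  then show ?thesis using sums_single[of 0 "\<lambda>_. e"] by (simp add: disc_series_def sums_iff)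
qed

lemma hardy_eval_const: "hardy_eval (hardy_const e) z = (if z \<in> ball 0 1 then e else 0)"
  unfolding hardy_const_def
  by (subst hardy_eval_Abs[OF sq_summable_finite[of e]]) (auto simp: disc_series_const)

lemma hardy_coeff_const: "hardy_coeff (hardy_const e) = (\<lambda>n. if n = 0 then e else 0)"
  by (rule hardy_coeff_unique)
    (auto simp: sq_summable_finite hardy_eval_const disc_series_const fun_eq_iff)

lemma hardy_eval_zero: "hardy_eval f 0 = hardy_coeff f 0"
proof -
  have "(\<lambda>n. 0 ^ n *\<^sub>C hardy_coeff f n) = (\<lambda>n. if n = 0 then hardy_coeff f 0 else 0)"
    by (auto simp: fun_eq_iff power_0_left)
  then show ?thesis using sums_single[of 0 "\<lambda>_. hardy_coeff f 0"]
    by (simp add: hardy_coeff(2)[of f] disc_series_def sums_iff)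
qed

lemma cinner_hardy_const: "cinner f (hardy_const e) = cinner (hardy_eval f 0) e"
proof -
  have "(\<lambda>n. cinner (hardy_coeff f n) (if n = 0 then e else 0))
      = (\<lambda>n. if n = 0 then cinner (hardy_coeff f 0) e else 0)" by auto
  then show ?thesis using sums_single[of 0 "\<lambda>_. cinner (hardy_coeff f 0) e"]
    by (simp add: cinner_hardy_def hardy_coeff_const hardy_eval_zero sums_iff)
qed

lemma proj_const_eq: "proj_const f = hardy_const (hardy_eval f 0)"
  unfolding proj_const_def orth_proj_def
proof (rule the_equality)
  fix p assume p: "p \<in> range hardy_const \<and> (\<forall>m\<in>range hardy_const. cinner (f - p) m = 0)"
  then obtain e where e: "p = hardy_const e" by auto
  have "cinner (hardy_eval f 0 - e) x = 0" for x
    using p by (auto simp: e cinner_diff_left cinner_hardy_const hardy_eval_const)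
  from this[of "hardy_eval f 0 - e"] show "p = hardy_const (hardy_eval f 0)"
    by (simp add: cinner_self e)
qed (auto simp: cinner_diff_left cinner_hardy_const hardy_eval_const)

end

theory Submission
  imports Defs
begin

text \<open>
  Write \<open>M\<close> for the operator matrix and \<open>X\<^sub>n\<close> for the corner entry of
  \<open>M\<^sup>n\<close>.  If \<open>M\<close> is similar to a contraction, the \<open>X\<^sub>n\<close> are
  uniformly bounded; hence the series \<open>A = \<Sum> S\<^sup>*\<^sup>k X S\<^sup>*\<^sup>k\<close> converges strongly, it
  solves \<open>X = A - S\<^sup>* A S\<^sup>*\<close>, and
  \<open>\<Sum> \<parallel>P\<^sub>E A S\<^sup>*\<^sup>k h\<parallel>\<^sup>2 \<le> C\<^sup>2 \<parallel>h\<parallel>\<^sup>2\<close>.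
  This square bound says that \<open>h \<mapsto> (P\<^sub>E A S\<^sup>*\<^sup>k h)\<^sub>k\<close> is the adjoint of a bounded
  multiplication operator, so it is equivalent to \<open>A\<^sup>* P\<^sub>E = \<Psi> P\<^sub>E\<close> with \<open>\<Psi>\<close>
  bounded.  Conversely, it provides an equivalent Hilbert norm in which \<open>M\<close> is a contraction.
\<close>

section \<open>Bounded operators and adjoints\<close>

text \<open>Write \<open>B\<close> for the backward shift. The shear by \<open>B A\<close>, which
  sends (f, g) to (f + B A g, g), conjugates the matrix into one with the same diagonal and corner
  \<open>A - S B A\<close>, which is the projection of \<open>A\<close> to the constants. Constants
  are orthogonal to the range of \<open>S\<close>, so one step raises the squared norm of the first
  component by exactly the squared norm of the constant term of \<open>A g\<close>. Let \<Gamma> h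
  have the coefficients of the square bound. Since \<Gamma> B = B \<Gamma>, the squared norm of
  \<Gamma> g drops by the same amount in that step, so adding it to the norm pays for the growth,
  and boundedness of \<Gamma> keeps the new norm equivalent. Similarity asks for an operator on the
  given space, so this norm has to be realised there; that is the role of the square root of the
  identity plus \<Gamma>^* \<Gamma>. Boundary values on the unit circle are avoided: pointwise
  bounds on the disc become norm bounds through finite Parseval identities on circles of radius r <
  1.\<close>

lemma bounded_clinearD:
  assumes "bounded_clinear T"
  shows bounded_clinear_add: "T (x + y) = T x + T y"
    and bounded_clinear_diff: "T (x - y) = T x - T y"
    and bounded_clinear_zero: "T 0 = 0"
    and bounded_clinear_scaleC: "T (c *\<^sub>C x) = c *\<^sub>C T x"
    and bounded_clinear_imp_linear: "bounded_linear T"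
    and bounded_clinear_sum: "T (sum h I) = (\<Sum>i\<in>I. T (h i))"
proof -
  have bl: "bounded_linear T" and sc: "\<And>c x. T (c *\<^sub>C x) = c *\<^sub>C T x"
    using assms by (auto simp: bounded_clinear_def)
  interpret bounded_linear T by fact
  show "T (x + y) = T x + T y" "T (x - y) = T x - T y" "T 0 = 0"
    "T (c *\<^sub>C x) = c *\<^sub>C T x" "bounded_linear T" "T (sum h I) = (\<Sum>i\<in>I. T (h i))"
    by (auto simp: add diff zero sc bl sum)
qed

lemma bounded_clinearI:
  assumes "\<And>x y. T (x + y) = T x + T y" and "\<And>c x. T (c *\<^sub>C x) = c *\<^sub>C T x"
    and "\<And>x. norm (T x) \<le> K * norm x"
  shows "bounded_clinear T"
  unfolding bounded_clinear_def
proof (intro conjI allI bounded_linear_intro[where K = K])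
  show "T (r *\<^sub>R x) = r *\<^sub>R T x" for r x
    by (metis assms(2) scaleC_of_real)
qed (use assms in \<open>auto simp: mult.commute\<close>)

lemma bounded_clinear_pos_bound:
  assumes "bounded_clinear T"
  obtains K where "0 < K" "\<And>x. norm (T x) \<le> K * norm x"
  using bounded_linear.pos_bounded[OF bounded_clinear_imp_linear[OF assms]]
  by (auto simp: mult.commute)

lemma bounded_clinear_compose:
  "bounded_clinear S \<Longrightarrow> bounded_clinear T \<Longrightarrow> bounded_clinear (\<lambda>x. S (T x))"
  by (auto simp: bounded_clinear_def intro: bounded_linear_compose)

lemma bounded_clinear_id: "bounded_clinear (\<lambda>x. x)"
  by (simp add: bounded_clinear_def)

lemma bounded_clinear_zero_fun: "bounded_clinear (\<lambda>x. 0)"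
  by (simp add: bounded_clinear_def)

lemma bounded_clinear_add_fun:
  "bounded_clinear S \<Longrightarrow> bounded_clinear T \<Longrightarrow> bounded_clinear (\<lambda>x. S x + T x)"
  by (auto simp: bounded_clinear_def scaleC_add_right intro: bounded_linear_add)

lemma bounded_clinear_diff_fun:
  "bounded_clinear S \<Longrightarrow> bounded_clinear T \<Longrightarrow> bounded_clinear (\<lambda>x. S x - T x)"
  by (auto simp: bounded_clinear_def scaleC_diff_right intro: bounded_linear_sub)

lemma bounded_clinear_scaleC_fun:
  "bounded_clinear T \<Longrightarrow> bounded_clinear (\<lambda>x. c *\<^sub>C T x)"
  using bounded_linear_compose[OF bounded_linear_scaleC]
  by (auto simp: bounded_clinear_def scaleC_scaleC mult.commute)

lemma bounded_clinear_funpow: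
  fixes T :: "'a::complex_inner \<Rightarrow> 'a"
  shows "bounded_clinear T \<Longrightarrow> bounded_clinear (T ^^ n)"
proof (induction n)
  case 0
  then show ?case using bounded_clinear_id by (simp add: id_def)
next
  case (Suc n)
  then show ?case using bounded_clinear_compose[of T "T ^^ n"] by (simp add: o_def)
qed

lemma bounded_clinear_Pair:
  "bounded_clinear S \<Longrightarrow> bounded_clinear T \<Longrightarrow> bounded_clinear (\<lambda>x. (S x, T x))"
  by (auto simp: bounded_clinear_def scaleC_prod_def intro: bounded_linear_Pair)

lemma bounded_clinear_fst: "bounded_clinear fst"
  and bounded_clinear_snd: "bounded_clinear snd"
  by (auto simp: bounded_clinear_def scaleC_prod_def bounded_linear_fst bounded_linear_snd)

lemma scaleC_scaleR_commute:
  fixes x :: "'a::complex_inner"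
  shows "c *\<^sub>C r *\<^sub>R x = r *\<^sub>R c *\<^sub>C x"
  by (simp flip: scaleC_of_real add: scaleC_scaleC mult.commute)

lemma cinner_scaleR_left:
  fixes x :: "'a::complex_inner"
  shows "cinner (r *\<^sub>R x) y = of_real r * cinner x y"
  by (metis cinner_scaleC_left scaleC_of_real)

lemma cinner_scaleR_right:
  fixes x :: "'a::complex_inner"
  shows "cinner x (r *\<^sub>R y) = of_real r * cinner x y"
  by (metis cinner_scaleC_right complex_cnj_complex_of_real scaleC_of_real)

lemma cinner_minus_right:
  fixes x y :: "'a::complex_inner"
  shows "cinner x (- y) = - cinner x y"
  using cinner_diff_right[of x 0 y] by simp

lemma cinner_sum_left: "cinner (sum h I) y = (\<Sum>i\<in>I. cinner (h i) y)"
  by (rule linear_sum[OF bounded_linear.linear[OF bounded_linear_cinner_left]])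

lemma cinner_sum_right: "cinner x (sum h I) = (\<Sum>i\<in>I. cinner x (h i))"
  by (subst cinner_commute, subst cinner_sum_left) (simp add: cinner_commute[symmetric] cnj_sum)

section \<open>Riesz representation and the existence of adjoints\<close>

text \<open>A complex homogeneous functional is determined by its real part, because its imaginary
  part at \<open>x\<close> is minus its real part at \<open>\<i> *\<^sub>C x\<close>. Hence the real
  representing vector also serves for \<open>cinner\<close>.\<close>

lemma cinner_eq_iff_inner:
  fixes v :: "'a::complex_inner"
  assumes "\<And>c x. \<phi> (c *\<^sub>C x) = c * \<phi> x" and "\<And>x. inner v x = Re (\<phi> x)"
  shows "\<phi> x = cinner x v"
proof (rule complex_eqI)
  show "Re (\<phi> x) = Re (cinner x v)" for x
    by (simp add: Re_cinner assms(2)[symmetric] inner_commute)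
  from this[of "\<i> *\<^sub>C x"] show "Im (\<phi> x) = Im (cinner x v)"
    by (simp add: assms(1) cinner_scaleC_left)
qed

text \<open>Parallelogram law for the functional minimised below: the linear terms cancel, so two
  near-minimisers must be close to each other.\<close>

lemma square_defect_real_functional:
  fixes x y :: "'a::real_inner" and \<phi> :: "'a \<Rightarrow> real"
  assumes "linear \<phi>"
  shows "(norm (x - y))\<^sup>2 = 2 * ((norm x)\<^sup>2 - 2 * \<phi> x) + 2 * ((norm y)\<^sup>2 - 2 * \<phi> y)
    - 4 * ((norm ((1/2) *\<^sub>R (x + y)))\<^sup>2 - 2 * \<phi> ((1/2) *\<^sub>R (x + y)))"
  unfolding power2_norm_eq_inner linear_cmul[OF assms] linear_add[OF assms]
  by (simp add: algebra_simps inner_commute)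

text \<open>The representing vector is the minimiser of \<open>\<parallel>x\<parallel>\<^sup>2 - 2 \<phi> x\<close>.\<close>

lemma real_riesz_representation:
  fixes \<phi> :: "'a::{real_inner, complete_space} \<Rightarrow> real"
  assumes "bounded_linear \<phi>"
  obtains v where "\<And>x. \<phi> x = inner v x"
proof -
  interpret bounded_linear \<phi> by fact
  define F where "F x = (norm x)\<^sup>2 - 2 * \<phi> x" for x
  define m where "m = Inf (range F)"
  obtain K where K: "0 < K" "\<And>x. norm (\<phi> x) \<le> norm x * K" using pos_bounded by blast
  \<comment> \<open>Completing the square in \<open>norm x\<close> gives the lower bound.\<close>
  have "F x \<ge> - K\<^sup>2" for x
  proof -
    have "\<phi> x \<le> norm x * K" using K(2)[of x] by simp
    then show ?thesis unfolding F_def using zero_le_power2[of "norm x - K"]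
      by (simp add: power2_diff)
  qed
  then have bdd: "bdd_below (range F)" by (auto simp: bdd_below_def)
  have m_le: "m \<le> F x" for x unfolding m_def using bdd by (rule cINF_lower) simp
  have "\<exists>x. F x < m + 1 / Suc n" for n
    using cInf_lessD[of "range F" "m + 1 / Suc n"] by (auto simp: m_def)
  then obtain x where x: "\<And>n. F (x n) < m + 1 / Suc n" by metis
  have close: "(norm (u - v))\<^sup>2 \<le> 2 * (F u - m) + 2 * (F v - m)" for u v
    using m_le[of "(1/2) *\<^sub>R (u + v)"] square_defect_real_functional[OF linear, of u v]
    by (simp add: F_def)
  have "Cauchy x"
  proof (rule metric_CauchyI)
    fix e :: real assume e: "e > 0"
    then obtain N where N: "1 / Suc N < e\<^sup>2 / 4"
      using reals_Archimedean[of "e\<^sup>2 / 4"] by (auto simp: inverse_eq_divide)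
    have "dist (x k) (x l) < e" if "k \<ge> N" "l \<ge> N" for k l
    proof -
      have "1 / Suc k \<le> 1 / Suc N" "1 / Suc l \<le> 1 / Suc N"
        using that by (auto intro!: divide_left_mono simp del: of_nat_Suc)
      then have "F (x k) - m < e\<^sup>2 / 4" "F (x l) - m < e\<^sup>2 / 4"
        using x[of k] x[of l] N by (auto simp only: less_diff_eq diff_less_eq add.commute)
      then have "2 * (F (x k) - m) + 2 * (F (x l) - m) < e\<^sup>2" by simp
      with close[of "x k" "x l"] have "(norm (x k - x l))\<^sup>2 < e\<^sup>2"
        by (rule order_le_less_trans)
      then show ?thesis using e by (simp add: dist_norm power2_less_imp_less)
    qed
    then show "\<exists>N. \<forall>k\<ge>N. \<forall>l\<ge>N. dist (x k) (x l) < e" by blast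
  qed
  then obtain v where v: "x \<longlonglongrightarrow> v" by (auto simp: Cauchy_convergent_iff convergent_def)
  have "(\<lambda>n. F (x n)) \<longlonglongrightarrow> F v" unfolding F_def by (intro tendsto_intros v tendsto)
  moreover have "(\<lambda>n. m + 1 / Suc n) \<longlonglongrightarrow> m + 0"
    by (intro tendsto_intros LIMSEQ_Suc lim_inverse_n'[unfolded inverse_eq_divide])
  ultimately have "F v \<le> m + 0" by (rule LIMSEQ_le) (use x in \<open>auto intro: less_imp_le\<close>)
  then have Fv: "F v \<le> F y" for y using m_le[of y] by simp
  have "\<phi> y = inner v y" for y
  proof -
    define d where "d = inner v y - \<phi> y"
    have *: "0 \<le> 2 * t * d + t\<^sup>2 * (norm y)\<^sup>2" for t
      using Fv[of "v + t *\<^sub>R y"]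
      unfolding F_def d_def power2_norm_eq_inner add scaleR
      by (simp add: algebra_simps inner_commute power2_eq_square)
    \<comment> \<open>The first variation is tested at \<open>t = - d / q\<close>, close to the
      minimiser of the quadratic in \<open>t\<close>; the summand 1 keeps \<open>q\<close> positive
      when \<open>y = 0\<close>.\<close>
    define q where "q = 1 + (norm y)\<^sup>2"
    have q: "q > 0" "(norm y)\<^sup>2 \<le> q" by (auto simp: q_def add_pos_nonneg)
    from q have "(d / q)\<^sup>2 * (norm y)\<^sup>2 \<le> (d / q)\<^sup>2 * q" by (intro mult_left_mono) auto
    with *[of "- d / q"] have "0 \<le> 2 * (- d / q) * d + (d / q)\<^sup>2 * q" by simp
    also have "\<dots> = - (d\<^sup>2 / q)" using q by (simp add: field_simps power2_eq_square)
    finally have "d = 0" using q by (simp add: divide_le_0_iff)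
    then show ?thesis by (simp add: d_def)
  qed
  then show ?thesis by (rule that)
qed

lemma riesz_representation:
  fixes \<phi> :: "'a::chilbert_space \<Rightarrow> complex"
  assumes "bounded_clinear \<phi>"
  obtains v where "\<And>x. \<phi> x = cinner x v"
proof -
  have "bounded_linear (\<lambda>x. Re (\<phi> x))"
    using bounded_clinear_imp_linear[OF assms] by (rule bounded_linear_compose[OF bounded_linear_Re])
  then obtain v where v: "\<And>x. Re (\<phi> x) = inner v x" by (rule real_riesz_representation) blast
  show ?thesis
    by (rule that[of v], rule cinner_eq_iff_inner)
      (simp_all add: v bounded_clinear_scaleC[OF assms] scaleC_complex_def)
qed

text \<open>\<open>cadjoint\<close> is a definite description, so its identity holds only once some
  operator satisfies it; Riesz supplies the value at each \<open>y\<close>.\<close>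

lemma cinner_cadjoint:
  fixes T :: "'a::chilbert_space \<Rightarrow> 'b::complex_inner"
  assumes T: "bounded_clinear T"
  shows "cinner (T x) y = cinner x (cadjoint T y)"
proof -
  have "\<exists>v. \<forall>x. cinner (T x) y = cinner x v" for y
  proof -
    have "bounded_clinear (\<lambda>x. cinner x y)"
      by (simp add: bounded_clinear_def bounded_linear_cinner_left cinner_scaleC_left scaleC_complex_def)
    from bounded_clinear_compose[OF this T]
    have "bounded_clinear (\<lambda>x. cinner (T x) y)" .
    then show ?thesis by (rule riesz_representation) blast
  qed
  then obtain S where S: "\<And>x y. cinner (T x) y = cinner x (S y)" by metis
  from cadjoint_eqI[of T S, OF S] S show ?thesis by simp
qed

lemma cinner_cadjoint':
  fixes T :: "'a::chilbert_space \<Rightarrow> 'b::complex_inner"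
  assumes T: "bounded_clinear T"
  shows "cinner (cadjoint T y) x = cinner y (T x)"
  by (metis cinner_commute cinner_cadjoint[OF T])

lemma norm_cadjoint_le:
  fixes T :: "'a::chilbert_space \<Rightarrow> 'b::complex_inner"
  assumes T: "bounded_clinear T" and "0 \<le> K" and K: "\<And>x. norm (T x) \<le> K * norm x"
  shows "norm (cadjoint T y) \<le> K * norm y"
proof (cases "cadjoint T y = 0")
  case True
  then show ?thesis using \<open>0 \<le> K\<close> by simp
next
  case False
  define v where "v = cadjoint T y"
  have "complex_of_real ((norm v)\<^sup>2) = cinner (T v) y"
    unfolding cinner_cadjoint[OF T] v_def by (rule cinner_self[symmetric])
  then have "(norm v)\<^sup>2 = norm (cinner (T v) y)" by (metis abs_of_nonneg norm_of_real zero_le_power2)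
  also have "\<dots> \<le> norm (T v) * norm y" by (rule norm_cinner_le)
  also have "\<dots> \<le> (K * norm v) * norm y" by (intro mult_right_mono K) simp
  finally have "norm v * norm v \<le> norm v * (K * norm y)" by (simp add: power2_eq_square mult_ac)
  then show ?thesis using False by (simp add: v_def)
qed

lemma bounded_clinear_cadjoint:
  fixes T :: "'a::chilbert_space \<Rightarrow> 'b::complex_inner"
  assumes T: "bounded_clinear T"
  shows "bounded_clinear (cadjoint T)"
proof -
  obtain K where K: "0 \<le> K" "\<And>x. norm (T x) \<le> K * norm x"
    using bounded_clinear_pos_bound[OF T] less_imp_le by metis
  show ?thesis
  proof (rule bounded_clinearI[OF _ _ norm_cadjoint_le[OF T K]])
    show "cadjoint T (x + y) = cadjoint T x + cadjoint T y" for x y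
      by (rule cinner_eqI) (simp add: cinner_add_right flip: cinner_cadjoint[OF T])
    show "cadjoint T (c *\<^sub>C x) = c *\<^sub>C cadjoint T x" for c x
      by (rule cinner_eqI) (simp add: cinner_scaleC_right flip: cinner_cadjoint[OF T])
  qed
qed

section \<open>Square roots and roots of unity\<close>

text \<open>The square root is \<open>I - Y\<close> with \<open>Y\<close> the fixed point of
  \<open>Y \<mapsto> (R + Y\<^sup>2) / 2\<close>, where \<open>I - R\<close> is the given operator.\<close>

lemma selfadjoint_sqrt_exists:
  fixes R :: "'a::chilbert_space \<Rightarrow>\<^sub>L 'a"
  assumes small: "norm R \<le> 3 / 4"
    and clin: "\<And>c x. R (c *\<^sub>C x) = c *\<^sub>C R x"
    and sa: "\<And>x y. cinner (R x) y = cinner x (R y)"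
  obtains Y :: "'a \<Rightarrow>\<^sub>L 'a" where "norm Y \<le> 1 / 2" "\<And>c x. Y (c *\<^sub>C x) = c *\<^sub>C Y x"
    "\<And>x y. cinner (Y x) y = cinner x (Y y)" "\<And>x. x - R x = (x - Y x) - Y (x - Y x)"
proof -
  \<comment> \<open>The radius 1/2 matches the bound 3/4 on \<open>R\<close>: (3/4 + 1/4) / 2 = 1/2.
    Complex linearity and self-adjointness are closed conditions kept by the iteration, so the fixed
    point inherits them.\<close>
  define D where "D = {Y :: 'a \<Rightarrow>\<^sub>L 'a. norm Y \<le> 1 / 2 \<and>
    (\<forall>c x. blinfun_apply Y (c *\<^sub>C x) = c *\<^sub>C blinfun_apply Y x) \<and>
    (\<forall>x y. cinner (blinfun_apply Y x) y = cinner x (blinfun_apply Y y))}"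
  define F where "F Y = (1/2) *\<^sub>R (R + (Y o\<^sub>L Y))" for Y
  have cont: "continuous_on UNIV (\<lambda>Y :: 'a \<Rightarrow>\<^sub>L 'a. cinner (Y x) y)"
    "continuous_on UNIV (\<lambda>Y :: 'a \<Rightarrow>\<^sub>L 'a. cinner y (Y x))"
    "continuous_on UNIV (\<lambda>Y :: 'a \<Rightarrow>\<^sub>L 'a. c *\<^sub>C Y x)" for x y c
  proof -
    have 1: "continuous_on UNIV (\<lambda>Y :: 'a \<Rightarrow>\<^sub>L 'a. cinner (Y x) y)" for x y
      by (rule bounded_linear.continuous_on[OF bounded_linear_cinner_left]) (intro continuous_intros)
    show "continuous_on UNIV (\<lambda>Y :: 'a \<Rightarrow>\<^sub>L 'a. cinner (Y x) y)" by (rule 1)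
    have "continuous_on UNIV (\<lambda>Y :: 'a \<Rightarrow>\<^sub>L 'a. cnj (cinner (Y x) y))"
      by (intro continuous_intros 1)
    then show "continuous_on UNIV (\<lambda>Y :: 'a \<Rightarrow>\<^sub>L 'a. cinner y (Y x))"
      by (simp only: cinner_commute[symmetric])
    show "continuous_on UNIV (\<lambda>Y :: 'a \<Rightarrow>\<^sub>L 'a. c *\<^sub>C Y x)"
      by (rule bounded_linear.continuous_on[OF bounded_linear_scaleC]) (intro continuous_intros)
  qed
  have "closed D"
    unfolding D_def
    by (intro closed_Collect_conj closed_Collect_all closed_Collect_eq closed_Collect_le cont
        continuous_intros)
  then have "complete D" by (simp add: complete_eq_closed)
  moreover have "0 \<in> D" by (simp add: D_def)
  then have "D \<noteq> {}" by blast
  moreover have "F ` D \<subseteq> D"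
  proof
    fix Z assume "Z \<in> F ` D"
    then obtain Y where Y: "Y \<in> D" and Z: "Z = F Y" by blast
    have nY: "norm Y \<le> 1 / 2" and cY: "\<And>c x. Y (c *\<^sub>C x) = c *\<^sub>C Y x"
      and sY: "\<And>x y. cinner (Y x) y = cinner x (Y y)" using Y by (auto simp: D_def)
    have "norm (Y o\<^sub>L Y) \<le> norm Y * norm Y" by (rule norm_blinfun_compose)
    also have "\<dots> \<le> (1/2) * (1/2)" using nY by (intro mult_mono) auto
    finally have "norm (R + (Y o\<^sub>L Y)) \<le> 1" using small norm_triangle_ineq[of R "Y o\<^sub>L Y"] by simp
    then show "Z \<in> D"
      by (simp add: Z D_def F_def blinfun.bilinear_simps clin cY scaleC_add_right
          scaleC_scaleR_commute cinner_scaleR_left cinner_scaleR_right cinner_add_left cinner_add_right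
          sa sY)
  qed
  moreover have "dist (F Y) (F Z) \<le> 1 / 2 * dist Y Z" if "Y \<in> D" "Z \<in> D" for Y Z
  proof -
    have eq: "(Y o\<^sub>L Y) - (Z o\<^sub>L Z) = (Y o\<^sub>L (Y - Z)) + ((Y - Z) o\<^sub>L Z)"
      by (rule blinfun_eqI) (simp add: blinfun.bilinear_simps)
    have "norm ((Y o\<^sub>L Y) - (Z o\<^sub>L Z)) \<le> norm (Y o\<^sub>L (Y - Z)) + norm ((Y - Z) o\<^sub>L Z)"
      unfolding eq by (rule norm_triangle_ineq)
    also have "\<dots> \<le> norm Y * norm (Y - Z) + norm (Y - Z) * norm Z"
      by (intro add_mono norm_blinfun_compose)
    also have "\<dots> \<le> (1/2) * norm (Y - Z) + norm (Y - Z) * (1/2)"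
      using that by (intro add_mono mult_mono) (auto simp: D_def)
    finally have "norm ((Y o\<^sub>L Y) - (Z o\<^sub>L Z)) \<le> norm (Y - Z)" by simp
    moreover have "F Y - F Z = (1/2) *\<^sub>R ((Y o\<^sub>L Y) - (Z o\<^sub>L Z))"
      by (simp add: F_def scaleR_diff_right scaleR_add_right)
    ultimately show ?thesis by (simp add: dist_norm)
  qed
  ultimately obtain Y where Y: "Y \<in> D" "F Y = Y"
    using Banach_fix[of D "1/2" F] by auto
  have fix_eq: "2 *\<^sub>R Y x = R x + Y (Y x)" for x
  proof -
    have "Y x = (1/2) *\<^sub>R (R x + Y (Y x))"
      using arg_cong[OF Y(2), of "\<lambda>Z. blinfun_apply Z x"]
      by (simp add: F_def blinfun.bilinear_simps)
    then have "2 *\<^sub>R Y x = 2 *\<^sub>R ((1/2) *\<^sub>R (R x + Y (Y x)))" by (rule arg_cong)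
    then show ?thesis by simp
  qed
  have "x - R x = (x - Y x) - Y (x - Y x)" for x
    using fix_eq[of x] by (simp add: blinfun.bilinear_simps scaleR_2 algebra_simps)
  with Y(1) show ?thesis by (intro that[of Y]) (auto simp: D_def)
qed

text \<open>\<open>W\<close> is a self-adjoint square root of the identity plus \<Gamma>^* \<Gamma>,
  so its squared norm at \<open>x\<close> is the quadratic form of that operator. Smallness of
  \<Gamma> brings R = - \<Gamma>^* \<Gamma> within reach of the fixed-point construction.\<close>

lemma graph_norm_isomorphism:
  fixes \<Gamma> :: "'a::chilbert_space \<Rightarrow> 'b::chilbert_space"
  assumes \<Gamma>: "bounded_clinear \<Gamma>" and small: "\<And>x. norm (\<Gamma> x) \<le> 1 / 2 * norm x"
  obtains W V :: "'a \<Rightarrow> 'a" where "bounded_clinear W" "bounded_clinear V"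
    "\<And>x. V (W x) = x" "\<And>x. W (V x) = x"
    "\<And>x. (norm (W x))\<^sup>2 = (norm x)\<^sup>2 + (norm (\<Gamma> x))\<^sup>2"
proof -
  define T where "T x = - cadjoint \<Gamma> (\<Gamma> x)" for x
  have bc: "bounded_clinear (\<lambda>x. cadjoint \<Gamma> (\<Gamma> x))"
    by (intro bounded_clinear_compose[OF bounded_clinear_cadjoint] \<Gamma>)
  have T: "bounded_clinear T"
    using bounded_clinear_diff_fun[OF bounded_clinear_zero_fun bc] by (simp add: T_def[abs_def])
  define R where "R = Blinfun T"
  have R: "blinfun_apply R = T"
    unfolding R_def using bounded_clinear_imp_linear[OF T] by (rule bounded_linear_Blinfun_apply)
  have nT: "norm (T x) \<le> 3 / 4 * norm x" for x
  proof -
    have "norm (T x) \<le> 1 / 2 * norm (\<Gamma> x)"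
      unfolding T_def norm_minus_cancel by (rule norm_cadjoint_le[OF \<Gamma> _ small]) simp
    also have "\<dots> \<le> 1 / 2 * (1 / 2 * norm x)" by (intro mult_left_mono small) simp
    also have "\<dots> \<le> 3 / 4 * norm x" by simp
    finally show ?thesis .
  qed
  have "norm R \<le> 3 / 4" using nT by (intro norm_blinfun_bound) (simp_all add: R)
  moreover have "R (c *\<^sub>C x) = c *\<^sub>C R x" for c x by (simp add: R bounded_clinear_scaleC[OF T])
  moreover have "cinner (R x) y = cinner x (R y)" for x y
    unfolding R T_def
    by (simp add: cinner_minus_left cinner_minus_right cinner_cadjoint'[OF \<Gamma>] cinner_cadjoint[OF \<Gamma>, symmetric])
  ultimately obtain Y :: "'a \<Rightarrow>\<^sub>L 'a" where Y: "norm Y \<le> 1 / 2" "\<And>c x. Y (c *\<^sub>C x) = c *\<^sub>C Y x"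
    "\<And>x y. cinner (Y x) y = cinner x (Y y)" "\<And>x. x - R x = (x - Y x) - Y (x - Y x)"
    using selfadjoint_sqrt_exists[of R] by metis
  define W where "W x = x - Y x" for x
  have Wadd: "W (x + y) = W x + W y" and Wsc: "W (c *\<^sub>C x) = c *\<^sub>C W x" for x y c
    by (simp_all add: W_def blinfun.bilinear_simps Y(2) scaleC_diff_right)
  have "bounded_linear W" unfolding W_def[abs_def]
    by (intro bounded_linear_sub bounded_linear_ident blinfun.bounded_linear_right)
  then have W: "bounded_clinear W" by (simp add: bounded_clinear_def Wsc)
  have normW: "(norm (W x))\<^sup>2 = (norm x)\<^sup>2 + (norm (\<Gamma> x))\<^sup>2" for x
  proof -
    have "cinner (W x) (W x) = cinner (W (W x)) x"
      unfolding W_def by (simp only: cinner_diff_left cinner_diff_right blinfun.diff_right Y(3))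
    also have "W (W x) = x - R x" by (simp add: W_def Y(4))
    also have "cinner (x - R x) x = cinner x x + cinner (\<Gamma> x) (\<Gamma> x)"
      by (simp add: R T_def cinner_add_left cinner_cadjoint'[OF \<Gamma>])
    finally have "complex_of_real ((norm (W x))\<^sup>2)
        = complex_of_real ((norm x)\<^sup>2 + (norm (\<Gamma> x))\<^sup>2)"
      by (simp only: cinner_self of_real_add)
    then show ?thesis by (simp only: of_real_eq_iff)
  qed
  have below: "norm x \<le> norm (W x)" for x
    by (rule power2_le_imp_le) (simp_all add: normW)
  \<comment> \<open>Since \<open>W\<close> is the identity minus \<open>Y\<close>, a preimage of
    \<open>y\<close> is a fixed point of \<open>\<lambda>x. y + Y x\<close>, a contraction with
    factor 1/2.\<close>
  have "\<exists>x. W x = y" for y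
  proof -
    have "dist (y + Y x) (y + Y z) \<le> 1 / 2 * dist x z" for x z
    proof -
      have "dist (y + Y x) (y + Y z) = norm (Y (x - z))"
        by (simp add: dist_norm blinfun.bilinear_simps)
      also have "\<dots> \<le> norm Y * norm (x - z)" by (rule norm_blinfun)
      also have "\<dots> \<le> 1 / 2 * norm (x - z)" using Y(1) by (intro mult_right_mono) auto
      finally show ?thesis by (simp add: dist_norm)
    qed
    then obtain x where "y + Y x = x" using banach_fix_type[of "1/2" "\<lambda>x. y + Y x"] by auto
    then have "W x = y" by (simp add: W_def diff_eq_eq)
    then show ?thesis by blast
  qed
  then obtain V where V: "\<And>y. W (V y) = y" by metis
  have inj: "x = y" if "W x = W y" for x y
    using below[of "x - y"] that by (simp add: bounded_clinear_diff[OF W])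
  have VW: "V (W x) = x" for x by (rule inj) (simp add: V)
  have "bounded_clinear V"
  proof (rule bounded_clinearI[where K = 1])
    show "V (x + y) = V x + V y" for x y by (rule inj) (simp add: V Wadd)
    show "V (c *\<^sub>C x) = c *\<^sub>C V x" for c x by (rule inj) (simp add: V Wsc)
    show "norm (V x) \<le> 1 * norm x" for x using below[of "V x"] by (simp add: V)
  qed
  with W VW V normW show ?thesis using that by blast
qed

section \<open>Finite Fourier analysis\<close>

lemma sum_roots_of_unity_orthogonal:
  fixes N n m :: nat
  assumes "n < N" "m < N"
  defines "w \<equiv> (\<lambda>j. cis (2 * pi * real j / real N))"
  shows "(\<Sum>j<N. w j ^ n * cnj (w j ^ m)) = (if n = m then of_nat N else 0)"
proof (cases "n = m")
  case True
  have "w j ^ n * cnj (w j ^ n) = 1" for j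
    by (simp only: w_def complex_norm_square[symmetric] norm_power norm_cis) simp
  then show ?thesis using True by simp
next
  case False
  define q where "q = w n * cnj (w m)"
  have N: "N > 0" using assms by simp
  \<comment> \<open>Exchanging node and exponent turns the sum over nodes into a geometric series
    with ratio \<open>q\<close>, where \<open>q \<noteq> 1\<close> and
    \<open>q ^ N = 1\<close>.\<close>
  have swap: "w j ^ k = w k ^ j" for j k
    unfolding w_def Complex.DeMoivre by (rule arg_cong[of _ _ cis]) simp
  have wN: "w k ^ N = 1" for k
    using N cis_multiple_2pi[of "real k"] by (simp add: w_def Complex.DeMoivre)
  have "w n \<noteq> w m"
    using bij_betw_imp_inj_on[OF Complex.bij_betw_roots_unity[OF N]] False assms
    unfolding w_def by (auto dest!: inj_onD)
  moreover have "w n = q * w m" unfolding q_def w_def by (simp add: cis_cnj cis_mult)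
  ultimately have "q \<noteq> 1" by auto
  have "(\<Sum>j<N. w j ^ n * cnj (w j ^ m)) = (\<Sum>j<N. q ^ j)"
    by (simp add: swap[of _ n] swap[of _ m] q_def power_mult_distrib)
  also have "\<dots> = (q ^ N - 1) / (q - 1)" using \<open>q \<noteq> 1\<close> by (rule geometric_sum)
  also have "q ^ N = 1" by (simp add: q_def power_mult_distrib wN flip: complex_cnj_power)
  finally show ?thesis using False by simp
qed

lemma discrete_parseval:
  fixes a :: "nat \<Rightarrow> 'a::complex_inner" and N :: nat
  defines "w \<equiv> (\<lambda>j. cis (2 * pi * real j / real N))"
  shows "(\<Sum>j<N. (norm (\<Sum>n<N. w j ^ n *\<^sub>C a n))\<^sup>2) = N * (\<Sum>n<N. (norm (a n))\<^sup>2)"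
proof -
  have "complex_of_real (\<Sum>j<N. (norm (\<Sum>n<N. w j ^ n *\<^sub>C a n))\<^sup>2)
      = (\<Sum>j<N. \<Sum>n<N. \<Sum>m<N. (w j ^ n * cnj (w j ^ m)) * cinner (a n) (a m))"
    by (simp add: cinner_self[symmetric] cinner_sum_left cinner_sum_right cinner_scaleC_left
        cinner_scaleC_right sum_distrib_left mult_ac del: of_real_power)
      (intro sum.cong refl sum.swap)
  also have "\<dots> = (\<Sum>n<N. \<Sum>m<N. (\<Sum>j<N. w j ^ n * cnj (w j ^ m)) * cinner (a n) (a m))"
    unfolding sum_distrib_right
    by (subst sum.swap, rule sum.cong[OF refl], subst sum.swap, rule refl)
  also have "\<dots> = (\<Sum>n<N. \<Sum>m<N. (if n = m then of_nat N else 0) * cinner (a n) (a m))"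
    unfolding w_def
    by (intro sum.cong refl arg_cong2[where f = "(*)"] sum_roots_of_unity_orthogonal) auto
  also have "\<dots> = (\<Sum>n<N. of_nat N * cinner (a n) (a n))"
    by (intro sum.cong refl) (simp add: if_distribR if_distrib[of "\<lambda>x. x * _"] cong: if_cong)
  also have "\<dots> = complex_of_real (N * (\<Sum>n<N. (norm (a n))\<^sup>2))"
    by (simp add: cinner_self sum_distrib_left)
  finally show ?thesis by (simp only: of_real_eq_iff)
qed

text \<open>The square-root form of Parseval lets the triangle inequality for \<open>L2_set\<close>
  absorb truncation errors later.\<close>

lemma L2_set_roots_of_unity:
  fixes a :: "nat \<Rightarrow> 'a::complex_inner" and N :: nat
  defines "w \<equiv> (\<lambda>j. cis (2 * pi * real j / real N))"
  shows "L2_set (\<lambda>j. norm (\<Sum>n<N. w j ^ n *\<^sub>C a n)) {..<N} = sqrt N * L2_set (\<lambda>n. norm (a n)) {..<N}"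
  unfolding L2_set_def w_def by (simp only: discrete_parseval real_sqrt_mult)

section \<open>The shift on the Hardy space\<close>

lemma hardy_coeff_shift:
  "hardy_coeff (hardy_shift f) = (\<lambda>n. case n of 0 \<Rightarrow> 0 | Suc m \<Rightarrow> hardy_coeff f m)"
  by (rule hardy_coeff_unique)
    (auto simp: sq_summable_shift[OF hardy_coeff(1)] hardy_eval_shift fun_eq_iff
      disc_series_shift[OF hardy_coeff(1)] hardy_coeff(2)[of f])

lemma sq_summable_tail: "sq_summable a \<Longrightarrow> sq_summable (\<lambda>n. a (n + k))"
  unfolding sq_summable_def by (simp add: summable_iff_shift[of "\<lambda>n. (norm (a n))\<^sup>2"])

lemma hardy_coeff_eqI: "(\<And>n. hardy_coeff f n = hardy_coeff g n) \<Longrightarrow> f = g"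
  using hardy_coeff_inject[of f g] by auto

lemma norm_hardy_square_Suc:
  "(norm f)\<^sup>2 = (norm (hardy_coeff f 0))\<^sup>2 + (\<Sum>n. (norm (hardy_coeff f (Suc n)))\<^sup>2)"
  unfolding norm_hardy_square
  by (subst suminf_split_head) (use hardy_coeff(1)[of f] in \<open>auto simp: sq_summable_def\<close>)

lemma norm_hardy_shift: "norm (hardy_shift f) = norm f"
proof -
  have "(norm (hardy_shift f))\<^sup>2 = (norm f)\<^sup>2"
    unfolding norm_hardy_square_Suc[of "hardy_shift f"] norm_hardy_square[of f]
    by (simp add: hardy_coeff_shift)
  then show ?thesis by (rule power2_eq_imp_eq) simp_all
qed

lemma bounded_clinear_hardy_shift: "bounded_clinear hardy_shift"
  by (rule bounded_clinearI[where K = 1])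
    (auto intro!: hardy_coeff_eqI simp: hardy_coeff_shift hardy_coeff_ops norm_hardy_shift split: nat.split)

abbreviation (input) backward_shift :: "'e::chilbert_space hardy \<Rightarrow> 'e hardy"
  where "backward_shift \<equiv> cadjoint hardy_shift"

text \<open>The left translation of coefficients satisfies the adjoint identity, and adjoints are
  unique.\<close>

lemma hardy_coeff_backward_shift: "hardy_coeff (backward_shift f) n = hardy_coeff f (Suc n)"
proof -
  have "\<exists>g. hardy_coeff g = (\<lambda>n. hardy_coeff f (Suc n))" for f :: "'a hardy"
    using hardy_exists[OF sq_summable_tail[OF hardy_coeff(1), of f 1]] by simp
  then obtain B :: "'a hardy \<Rightarrow> 'a hardy"
    where B: "\<And>f. hardy_coeff (B f) = (\<lambda>n. hardy_coeff f (Suc n))" by metis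
  have "cinner (hardy_shift f) g = cinner f (B g)" for f g
  proof -
    have "cinner (hardy_shift f) g
        = (\<Sum>n. cinner (hardy_coeff (hardy_shift f) (Suc n)) (hardy_coeff g (Suc n)))
          + cinner (hardy_coeff (hardy_shift f) 0) (hardy_coeff g 0)"
      unfolding cinner_hardy_def by (subst suminf_split_head[OF summable_cinner]) simp
    then show ?thesis by (simp add: cinner_hardy_def hardy_coeff_shift B)
  qed
  then have "backward_shift = B" by (rule cadjoint_eqI)
  then show ?thesis by (simp add: B)
qed

lemma bounded_clinear_backward_shift: "bounded_clinear backward_shift"
  by (rule bounded_clinear_cadjoint[OF bounded_clinear_hardy_shift])

lemma hardy_coeff_backward_shift_funpow:
  "hardy_coeff ((backward_shift ^^ k) f) n = hardy_coeff f (n + k)"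
  by (induction k arbitrary: n) (simp_all add: hardy_coeff_backward_shift)

lemma norm_shift_funpow: "norm ((hardy_shift ^^ k) f) = norm f"
  by (induction k) (simp_all add: norm_hardy_shift)

text \<open>An equality is needed here: this exact loss balances the gain in the first component of
  the operator matrix.\<close>

lemma norm_backward_shift_square:
  "(norm (backward_shift f))\<^sup>2 = (norm f)\<^sup>2 - (norm (hardy_coeff f 0))\<^sup>2"
  by (simp add: norm_hardy_square[of "backward_shift f"] norm_hardy_square_Suc[of f]
      hardy_coeff_backward_shift)

lemma norm_backward_shift_le: "norm (backward_shift f) \<le> norm f"
  by (rule power2_le_imp_le) (simp_all add: norm_backward_shift_square)

lemma norm_backward_shift_funpow_le: "norm ((backward_shift ^^ k) f) \<le> norm f"
  by (induction k) (auto intro: order_trans[OF norm_backward_shift_le])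

lemma backward_shift_shift: "backward_shift (hardy_shift f) = f"
  by (rule hardy_coeff_eqI) (simp add: hardy_coeff_backward_shift hardy_coeff_shift)

lemma backward_shift_funpow_shift_funpow: "(backward_shift ^^ k) ((hardy_shift ^^ k) f) = f"
  by (induction k) (simp_all add: funpow_swap1[of backward_shift] backward_shift_shift)

lemma shift_backward_shift: "hardy_shift (backward_shift f) + proj_const f = f"
  by (rule hardy_coeff_eqI)
    (simp add: hardy_coeff_backward_shift hardy_coeff_shift hardy_coeff_ops proj_const_eq
      hardy_coeff_const hardy_eval_zero split: nat.split)

lemma backward_shift_const: "backward_shift (hardy_const e) = 0"
  by (rule hardy_coeff_eqI) (simp add: hardy_coeff_backward_shift hardy_coeff_const hardy_coeff_ops)

lemma proj_const_const: "proj_const (hardy_const e) = hardy_const e"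
  by (simp add: proj_const_eq hardy_eval_const)

lemma norm_hardy_const: "norm (hardy_const e) = norm e"
  using norm_hardy_square_Suc[of "hardy_const e"] by (simp add: hardy_coeff_const)

lemma bounded_clinear_hardy_const: "bounded_clinear hardy_const"
  by (rule bounded_clinearI[where K = 1])
    (auto intro!: hardy_coeff_eqI simp: hardy_coeff_const hardy_coeff_ops norm_hardy_const)

text \<open>The range of the shift is orthogonal to the constants.\<close>

lemma norm_shift_add_const:
  "(norm (hardy_shift f + hardy_const e))\<^sup>2 = (norm f)\<^sup>2 + (norm e)\<^sup>2"
  unfolding norm_hardy_square_Suc[of "hardy_shift f + hardy_const e"]
  by (simp add: norm_hardy_square[of f] hardy_coeff_ops hardy_coeff_shift hardy_coeff_const)

lemma backward_shift_funpow_tendsto_0: "(\<lambda>k. (backward_shift ^^ k) f) \<longlonglongrightarrow> 0"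
proof -
  have "(\<lambda>k. (norm ((backward_shift ^^ k) f))\<^sup>2) \<longlonglongrightarrow> 0"
    unfolding norm_hardy_square hardy_coeff_backward_shift_funpow
    using hardy_coeff(1)[of f] unfolding sq_summable_def
    by (rule suminf_exist_split2)
  from tendsto_real_sqrt[OF this] show ?thesis
    by (simp add: tendsto_norm_zero_iff)
qed

section \<open>Point evaluations, and norm bounds from pointwise bounds\<close>

lemma bounded_clinear_hardy_eval:
  assumes z: "z \<in> ball 0 1"
  shows "bounded_clinear (\<lambda>f :: 'e::chilbert_space hardy. hardy_eval f z)"
proof -
  define K where "K = (\<Sum>n. cmod z ^ n)"
  have sg: "summable (\<lambda>n. cmod z ^ n)" using z by (intro summable_geometric) auto
  have ev: "hardy_eval f z = (\<Sum>n. z ^ n *\<^sub>C hardy_coeff f n)" for f :: "'e hardy"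
    using z by (simp add: hardy_coeff(2)[of f] disc_series_def)
  show ?thesis
  proof (rule bounded_clinearI[where K = K])
    fix f g :: "'e hardy" and c :: complex
    show "hardy_eval (f + g) z = hardy_eval f z + hardy_eval g z"
      unfolding hardy_coeff(2) hardy_coeff_ops by (rule disc_series_add; rule hardy_coeff(1))
    show "hardy_eval (c *\<^sub>C f) z = c *\<^sub>C hardy_eval f z"
      unfolding hardy_coeff(2) hardy_coeff_ops by (rule disc_series_scaleC; rule hardy_coeff(1))
    have sn: "summable (\<lambda>n. norm (z ^ n *\<^sub>C hardy_coeff f n))"
      by (rule summable_norm_disc[OF hardy_coeff(1) z])
    have "norm (hardy_eval f z) \<le> (\<Sum>n. norm (z ^ n *\<^sub>C hardy_coeff f n))"
      unfolding ev by (rule summable_norm[OF sn])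
    also have "\<dots> \<le> (\<Sum>n. cmod z ^ n * norm f)"
      by (intro suminf_le sn summable_mult2 sg)
        (auto simp: norm_scaleC norm_power intro!: mult_left_mono norm_hardy_coeff_le)
    also have "\<dots> = K * norm f" unfolding K_def by (rule suminf_mult2[OF sg, symmetric])
    finally show "norm (hardy_eval f z) \<le> K * norm f" .
  qed
qed

lemma hardy_eval_shift_funpow: "hardy_eval ((hardy_shift ^^ k) f) z = z ^ k *\<^sub>C hardy_eval f z"
  by (induction k) (simp_all add: hardy_eval_shift scaleC_scaleC)

text \<open>Sampling at the \<open>N\<close>-th roots of unity on the circle of radius \<open>r\<close>, where \<open>N \<rightarrow> \<infinity>\<close>,
  replaces integration over the circle.\<close>

lemma hardy_eval_approx:
  fixes f :: "'e::chilbert_space hardy"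
  assumes r: "0 \<le> r" "r < 1"
  obtains d where "d \<longlonglongrightarrow> 0"
    "\<And>N w. cmod w = 1 \<Longrightarrow>
      norm (hardy_eval f (of_real r * w) - (\<Sum>n<N. w ^ n *\<^sub>C of_real (r ^ n) *\<^sub>C hardy_coeff f n)) \<le> d N"
proof (rule that)
  \<comment> \<open>These terms do not involve \<open>w\<close>, so their tail bounds the truncation
    error at all sampling nodes at once.\<close>
  let ?b = "\<lambda>n. norm (of_real r ^ n *\<^sub>C hardy_coeff f n)"
  have sb: "summable ?b" using r by (intro summable_norm_disc hardy_coeff(1)) auto
  show "(\<lambda>N. \<Sum>n. ?b (n + N)) \<longlonglongrightarrow> 0" by (rule suminf_exist_split2[OF sb])
  fix N :: nat and w :: complex
  assume w: "cmod w = 1"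
  let ?z = "of_real r * w"
  have z: "?z \<in> ball 0 1" using r w by (simp add: norm_mult)
  note s = summable_disc[OF hardy_coeff(1) z, of f]
  have nb: "norm (?z ^ n *\<^sub>C hardy_coeff f n) = ?b n" for n
    by (simp add: norm_scaleC norm_power norm_mult w)
  have "hardy_eval f ?z = (\<Sum>n. ?z ^ (n + N) *\<^sub>C hardy_coeff f (n + N))
      + (\<Sum>n<N. ?z ^ n *\<^sub>C hardy_coeff f n)"
    using z suminf_split_initial_segment[OF s, of N]
    by (simp add: hardy_coeff(2)[of f] disc_series_def)
  moreover have "(\<Sum>n<N. ?z ^ n *\<^sub>C hardy_coeff f n)
      = (\<Sum>n<N. w ^ n *\<^sub>C of_real (r ^ n) *\<^sub>C hardy_coeff f n)"
    by (simp add: scaleC_scaleC power_mult_distrib mult.commute)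
  ultimately have "hardy_eval f ?z - (\<Sum>n<N. w ^ n *\<^sub>C of_real (r ^ n) *\<^sub>C hardy_coeff f n)
      = (\<Sum>n. ?z ^ (n + N) *\<^sub>C hardy_coeff f (n + N))" by simp
  also have "norm \<dots> \<le> (\<Sum>n. norm (?z ^ (n + N) *\<^sub>C hardy_coeff f (n + N)))"
    using summable_ignore_initial_segment[OF sb, of N] by (intro summable_norm) (unfold nb)
  finally show "norm (hardy_eval f ?z - (\<Sum>n<N. w ^ n *\<^sub>C of_real (r ^ n) *\<^sub>C hardy_coeff f n))
      \<le> (\<Sum>n. ?b (n + N))" unfolding nb .
qed

text \<open>At the \<open>N\<close>-th roots of unity, Parseval is exact for the Taylor polynomials
  with \<open>N\<close> terms. The pointwise hypothesis reaches these polynomials up to an error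
  that vanishes as \<open>N\<close> grows. Only the first \<open>M\<close> coefficients of
  \<open>g\<close> are kept on the left, so that \<open>N\<close>, then \<open>r\<close>, then
  \<open>M\<close> can be sent to their limits one after the other.\<close>

lemma norm_hardy_le_of_pointwise:
  fixes f g :: "'e::chilbert_space hardy"
  assumes C: "0 \<le> C"
    and le: "\<And>z. z \<in> ball 0 1 \<Longrightarrow> norm (hardy_eval g z) \<le> C * norm (hardy_eval f z)"
  shows "norm g \<le> C * norm f"
proof -
  have part: "(\<Sum>n<M. (r ^ n * norm (hardy_coeff g n))\<^sup>2) \<le> (C * norm f)\<^sup>2"
    if r: "0 \<le> r" "r < 1" for r :: real and M
  proof -
    define a where "a h n = complex_of_real (r ^ n) *\<^sub>C hardy_coeff h n" for h :: "'e hardy" and n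
    obtain d where d: "d \<longlonglongrightarrow> 0" "\<And>N w. cmod w = 1 \<Longrightarrow>
        norm (hardy_eval f (of_real r * w) - (\<Sum>n<N. w ^ n *\<^sub>C a f n)) \<le> d N"
      using hardy_eval_approx[OF r, of f] unfolding a_def by blast
    obtain d' where d': "d' \<longlonglongrightarrow> 0" "\<And>N w. cmod w = 1 \<Longrightarrow>
        norm (hardy_eval g (of_real r * w) - (\<Sum>n<N. w ^ n *\<^sub>C a g n)) \<le> d' N"
      using hardy_eval_approx[OF r, of g] unfolding a_def by blast
    have na: "norm (a h n) = r ^ n * norm (hardy_coeff h n)" for h n
      using r by (simp add: a_def norm_scaleC norm_power)
    have af: "L2_set (\<lambda>n. norm (a f n)) {..<N} \<le> norm f" for N
    proof -
      have "norm (a f n) \<le> norm (hardy_coeff f n)" for n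
        unfolding na using r by (intro mult_left_le_one_le) (auto intro: power_le_one)
      then have "(\<Sum>n<N. (norm (a f n))\<^sup>2) \<le> (\<Sum>n<N. (norm (hardy_coeff f n))\<^sup>2)"
        by (intro sum_mono power_mono) auto
      also have "\<dots> \<le> (norm f)\<^sup>2" by (rule sum_hardy_coeff_le)
      finally show ?thesis unfolding L2_set_def by (intro real_le_lsqrt) auto
    qed
    have key: "L2_set (\<lambda>n. norm (a g n)) {..<M} \<le> C * norm f + (C * d N + d' N)"
      if N: "N \<ge> M" "N > 0" for N
    proof -
      define w where "w j = cis (2 * pi * real j / real N)" for j
      have w: "cmod (w j) = 1" for j by (simp add: w_def)
      define P where "P h j = (\<Sum>n<N. w j ^ n *\<^sub>C a h n)" for h j
      have pointwise: "norm (P g j) \<le> C * norm (P f j) + (C * d N + d' N)" for j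
      proof -
        have z: "of_real r * w j \<in> ball 0 1" using r w[of j] by (simp add: norm_mult)
        have "norm (P g j) \<le> norm (hardy_eval g (of_real r * w j)) + d' N"
          using d'(2)[OF w, of j N] norm_triangle_ineq2[of "P g j" "hardy_eval g (of_real r * w j)"]
          by (simp add: P_def norm_minus_commute)
        moreover have "norm (hardy_eval f (of_real r * w j)) \<le> norm (P f j) + d N"
          using d(2)[OF w, of j N] norm_triangle_ineq2[of "hardy_eval f (of_real r * w j)" "P f j"]
          by (simp add: P_def)
        then have "C * norm (hardy_eval f (of_real r * w j)) \<le> C * (norm (P f j) + d N)"
          using C by (rule mult_left_mono)
        ultimately show ?thesis using le[OF z] by (simp add: algebra_simps)
      qed
      have L2P: "L2_set (\<lambda>j. norm (P h j)) {..<N} = sqrt N * L2_set (\<lambda>n. norm (a h n)) {..<N}" for h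
        unfolding P_def w_def by (rule L2_set_roots_of_unity)
      have dN: "0 \<le> d N" "0 \<le> d' N"
        using order_trans[OF norm_ge_zero d(2)[of 1]] order_trans[OF norm_ge_zero d'(2)[of 1]] by auto
      have "sqrt N * L2_set (\<lambda>n. norm (a g n)) {..<N}
          \<le> L2_set (\<lambda>j. C * norm (P f j) + (C * d N + d' N)) {..<N}"
        unfolding L2P[symmetric] by (intro L2_set_mono pointwise) simp
      also have "\<dots> \<le> L2_set (\<lambda>j. C * norm (P f j)) {..<N} + L2_set (\<lambda>j. C * d N + d' N) {..<N}"
        by (rule L2_set_triangle_ineq)
      also have "\<dots> = sqrt N * (C * L2_set (\<lambda>n. norm (a f n)) {..<N} + (C * d N + d' N))"
        using C dN by (simp add: L2_set_constant L2_set_right_distrib[OF C, symmetric] L2P algebra_simps)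
      also have "\<dots> \<le> sqrt N * (C * norm f + (C * d N + d' N))"
        using C by (intro mult_left_mono add_right_mono af) auto
      finally have "L2_set (\<lambda>n. norm (a g n)) {..<N} \<le> C * norm f + (C * d N + d' N)"
        using N by simp
      moreover have "L2_set (\<lambda>n. norm (a g n)) {..<M} \<le> L2_set (\<lambda>n. norm (a g n)) {..<N}"
        unfolding L2_set_def using N by (intro real_sqrt_le_mono sum_mono2) auto
      ultimately show ?thesis by simp
    qed
    have "(\<lambda>N. C * norm f + (C * d N + d' N)) \<longlonglongrightarrow> C * norm f + (C * 0 + 0)"
      by (intro tendsto_intros d(1) d'(1))
    then have "L2_set (\<lambda>n. norm (a g n)) {..<M} \<le> C * norm f + (C * 0 + 0)"
      by (rule LIMSEQ_le_const) (use key in \<open>auto intro!: exI[of _ "Suc M"]\<close>)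
    then show ?thesis
      unfolding L2_set_def na by (intro sqrt_le_D) simp
  qed
  have "(\<Sum>n<M. (norm (hardy_coeff g n))\<^sup>2) \<le> (C * norm f)\<^sup>2" for M
  proof (rule tendsto_upperbound)
    have "((\<lambda>r::real. \<Sum>n<M. (r ^ n * norm (hardy_coeff g n))\<^sup>2)
        \<longlongrightarrow> (\<Sum>n<M. (1 ^ n * norm (hardy_coeff g n))\<^sup>2)) (at_left 1)"
      by (intro tendsto_intros)
    then show "((\<lambda>r::real. \<Sum>n<M. (r ^ n * norm (hardy_coeff g n))\<^sup>2)
        \<longlongrightarrow> (\<Sum>n<M. (norm (hardy_coeff g n))\<^sup>2)) (at_left 1)" by simp
    show "\<forall>\<^sub>F r in at_left 1. (\<Sum>n<M. (r ^ n * norm (hardy_coeff g n))\<^sup>2) \<le> (C * norm f)\<^sup>2"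
      by (rule eventually_mono[OF eventually_at_left_real[OF zero_less_one]]) (rule part, simp_all)
  qed simp
  then have "(norm g)\<^sup>2 \<le> (C * norm f)\<^sup>2"
    unfolding norm_hardy_square[of g]
    using hardy_coeff(1)[of g] by (intro suminf_le_const) (auto simp: sq_summable_def)
  then show ?thesis by (rule power2_le_imp_le) (use C in simp)
qed

section \<open>Similarity to a contraction\<close>

text \<open>The map \<open>V\<close> carries the norm of \<open>V x\<close> to the original norm, so
  contractivity of \<open>T\<close> for the former is contractivity of its conjugate by
  \<open>V\<close>.\<close>

lemma similar_to_contractionI:
  fixes T V V' :: "'a::complex_inner \<Rightarrow> 'a"
  assumes V: "bounded_clinear V" "bounded_clinear V'" and inv: "\<And>x. V' (V x) = x" "\<And>x. V (V' x) = x"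
    and T: "bounded_clinear T" and le: "\<And>x. norm (V (T x)) \<le> norm (V x)"
  shows "similar_to_contraction T"
  unfolding similar_to_contraction_def
proof (intro exI conjI)
  show "bounded_clinear V'" "bounded_clinear V" "V \<circ> V' = id" "V' \<circ> V = id"
    using V inv by (auto simp: fun_eq_iff)
  have "onorm (V \<circ> T \<circ> V') \<le> 1"
    by (rule onorm_bound) (use le[of "V' _"] in \<open>simp_all add: inv\<close>)
  then show "contraction (V \<circ> T \<circ> V')"
    using bounded_clinear_compose[OF V(1) bounded_clinear_compose[OF T V(2)]]
    by (simp add: contraction_def o_def)
qed

lemma similar_to_contraction_power_bounded:
  fixes T :: "'a::complex_inner \<Rightarrow> 'a"
  assumes "similar_to_contraction T"
  obtains K where "0 \<le> K" "\<And>n x. norm ((T ^^ n) x) \<le> K * norm x"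
proof -
  obtain W V :: "'a \<Rightarrow> 'a" where W: "bounded_clinear W" and V: "bounded_clinear V"
    and inv: "V \<circ> W = id" "W \<circ> V = id" and C: "contraction (V \<circ> T \<circ> W)"
    using assms unfolding similar_to_contraction_def by blast
  have VW: "V (W x) = x" and WV: "W (V x) = x" for x
    using inv by (simp_all add: fun_eq_iff)
  obtain a where a: "0 < a" "\<And>x. norm (W x) \<le> a * norm x" using bounded_clinear_pos_bound[OF W] by blast
  obtain b where b: "0 < b" "\<And>x. norm (V x) \<le> b * norm x" using bounded_clinear_pos_bound[OF V] by blast
  have step: "norm (V (T x)) \<le> norm (V x)" for x
  proof -
    have bl: "bounded_linear (V \<circ> T \<circ> W)" using C by (simp add: contraction_def bounded_clinear_def)
    have "norm ((V \<circ> T \<circ> W) (V x)) \<le> onorm (V \<circ> T \<circ> W) * norm (V x)" by (rule onorm[OF bl])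
    also have "\<dots> \<le> 1 * norm (V x)" using C by (intro mult_right_mono) (auto simp: contraction_def)
    finally show ?thesis by (simp add: WV)
  qed
  have pow: "norm (V ((T ^^ n) x)) \<le> norm (V x)" for n x
    by (induction n) (auto intro: order_trans[OF step])
  show ?thesis
  proof (rule that[of "a * b"])
    show "norm ((T ^^ n) x) \<le> a * b * norm x" for n x
    proof -
      have "norm ((T ^^ n) x) \<le> a * norm (V ((T ^^ n) x))"
        using a(2)[of "V ((T ^^ n) x)"] by (simp add: WV)
      also have "\<dots> \<le> a * (b * norm x)"
        using a(1) by (intro mult_left_mono order_trans[OF pow b(2)]) auto
      finally show ?thesis by simp
    qed
  qed (use a b in simp)
qed

text \<open>For \<open>X = A - S\<^sup>* A S\<^sup>*\<close> and \<open>\<parallel>t \<Gamma>\<parallel> \<le> 1/2\<close> the operator matrix decreases the norm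
  \<open>t\<^sup>2 \<parallel>f + S\<^sup>* A g\<parallel>\<^sup>2 + \<parallel>g\<parallel>\<^sup>2 + t\<^sup>2 \<parallel>\<Gamma> g\<parallel>\<^sup>2\<close>, where
  \<open>\<Gamma> g\<close> has the coefficients \<open>P\<^sub>E A S\<^sup>*\<^sup>k g\<close>.\<close>

lemma similar_to_contraction_of_square_bound:
  fixes A :: "'e::chilbert_space hardy \<Rightarrow> 'e hardy"
  assumes A: "bounded_clinear A" and C: "0 \<le> C"
    and bound: "\<And>n h. (\<Sum>k<n. (norm (hardy_coeff (A ((backward_shift ^^ k) h)) 0))\<^sup>2) \<le> (C * norm h)\<^sup>2"
  shows "similar_to_contraction
    (upper_block hardy_shift (\<lambda>f. A f - backward_shift (A (backward_shift f))) backward_shift)"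
    (is "similar_to_contraction ?M")
proof -
  note S = bounded_clinear_hardy_shift and B = bounded_clinear_backward_shift
  define c where "c h k = hardy_coeff (A ((backward_shift ^^ k) h)) 0" for h k
  have sq: "sq_summable (c h)" for h
    unfolding sq_summable_def
  proof (rule bounded_imp_summable)
    show "(\<Sum>k\<le>m. (norm (c h k))\<^sup>2) \<le> (C * norm h)\<^sup>2" for m
      using bound[of h "Suc m"] by (simp add: c_def lessThan_Suc_atMost)
  qed simp
  \<comment> \<open>Storing the sequence as a Hardy function makes the intertwining with the
    backward shift a mere index shift.\<close>
  define \<Gamma> where "\<Gamma> h = Abs_hardy (disc_series (c h))" for h
  have \<Gamma>: "hardy_coeff (\<Gamma> h) = c h" for h
    unfolding \<Gamma>_def by (rule hardy_coeff_Abs[OF sq refl])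
  have nG: "norm (\<Gamma> h) \<le> C * norm h" for h
  proof (rule power2_le_imp_le)
    show "(norm (\<Gamma> h))\<^sup>2 \<le> (C * norm h)\<^sup>2"
      unfolding norm_hardy_square \<Gamma>
      using sq bound by (intro suminf_le_const) (auto simp: sq_summable_def c_def)
  qed (use C in simp)
  have bG: "bounded_clinear \<Gamma>"
  proof (rule bounded_clinearI[OF _ _ nG])
    note lin = bounded_clinearD[OF bounded_clinear_funpow[OF B]] bounded_clinearD[OF A] hardy_coeff_ops
    show "\<Gamma> (x + y) = \<Gamma> x + \<Gamma> y" for x y
      by (rule hardy_coeff_eqI) (simp add: \<Gamma> c_def lin)
    show "\<Gamma> (z *\<^sub>C x) = z *\<^sub>C \<Gamma> x" for z x
      by (rule hardy_coeff_eqI) (simp add: \<Gamma> c_def lin)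
  qed
  have shiftG: "\<Gamma> (backward_shift h) = backward_shift (\<Gamma> h)" for h
    by (rule hardy_coeff_eqI) (simp add: \<Gamma> c_def hardy_coeff_backward_shift funpow_swap1)
  \<comment> \<open>Scales \<Gamma> down to norm at most 1/2, as the square root requires;
    \<open>C + 1\<close> avoids division by zero when \<open>C = 0\<close>.\<close>
  define t where "t = 1 / (2 * (C + 1))"
  have t: "t > 0" "t * C \<le> 1 / 2" using C by (auto simp: t_def field_simps)
  have bT: "bounded_clinear (\<lambda>h. of_real t *\<^sub>C \<Gamma> h)" by (rule bounded_clinear_scaleC_fun[OF bG])
  have "norm (complex_of_real t *\<^sub>C \<Gamma> h) \<le> 1 / 2 * norm h" for h
  proof -
    have "norm (complex_of_real t *\<^sub>C \<Gamma> h) \<le> t * (C * norm h)"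
      using t nG by (simp add: norm_scaleC)
    also have "\<dots> \<le> 1 / 2 * norm h" using mult_right_mono[OF t(2), of "norm h"] by simp
    finally show ?thesis .
  qed
  then obtain W W' :: "'e hardy \<Rightarrow> 'e hardy" where W: "bounded_clinear W" "bounded_clinear W'"
    and inv: "\<And>x. W' (W x) = x" "\<And>x. W (W' x) = x"
    and nW: "\<And>x. (norm (W x))\<^sup>2 = (norm x)\<^sup>2 + (norm (complex_of_real t *\<^sub>C \<Gamma> x))\<^sup>2"
    using graph_norm_isomorphism[OF bT] by blast
  \<comment> \<open>The first entry carries the same factor \<open>t\<close> as \<Gamma> does inside
    \<open>W\<close>, so that gain and loss cancel exactly.\<close>
  define V where "V = (\<lambda>x. (complex_of_real t *\<^sub>C (fst x + backward_shift (A (snd x))), W (snd x)))"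
  define V' where "V' = (\<lambda>x. (complex_of_real (1 / t) *\<^sub>C fst x - backward_shift (A (W' (snd x))), W' (snd x)))"
  have M: "?M = (\<lambda>x. (hardy_shift (fst x) + (A (snd x) - backward_shift (A (backward_shift (snd x)))),
      backward_shift (snd x)))"
    by (auto simp: upper_block_def)
  note bc = bounded_clinear_Pair bounded_clinear_add_fun bounded_clinear_diff_fun
    bounded_clinear_scaleC_fun bounded_clinear_fst bounded_clinear_snd
    bounded_clinear_compose[OF A] bounded_clinear_compose[OF B] bounded_clinear_compose[OF S]
    bounded_clinear_compose[OF W(1)] bounded_clinear_compose[OF W(2)]
  show ?thesis
  proof (rule similar_to_contractionI)
    show "bounded_clinear V" unfolding V_def by (intro bc)
    show "bounded_clinear V'" unfolding V'_def by (intro bc)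
    show "bounded_clinear ?M" unfolding M by (intro bc)
    show "V' (V x) = x" for x
      using t(1) by (simp add: V_def V'_def inv scaleC_scaleC flip: of_real_mult)
    show "V (V' x) = x" for x
      using t(1) by (simp add: V_def V'_def inv scaleC_scaleC flip: of_real_mult)
    show "norm (V (?M x)) \<le> norm (V x)" for x
    proof (rule power2_le_imp_le)
      obtain f g where x: "x = (f, g)" by (cases x)
      define Y where "Y = f + backward_shift (A g)"
      have "hardy_shift f + (A g - backward_shift (A (backward_shift g))) + backward_shift (A (backward_shift g))
          = hardy_shift f + A g" by simp
      also have "\<dots> = hardy_shift Y + proj_const (A g)"
        using shift_backward_shift[of "A g"] by (simp add: Y_def bounded_clinear_add[OF S] add.assoc)
      finally have "V (?M x) = (complex_of_real t *\<^sub>C (hardy_shift Y + proj_const (A g)), W (backward_shift g))"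
        by (simp add: V_def x upper_block_def)
      then have "(norm (V (?M x)))\<^sup>2 = t\<^sup>2 * (norm (hardy_shift Y + proj_const (A g)))\<^sup>2
          + (norm (W (backward_shift g)))\<^sup>2"
        by (simp add: norm_prod_def norm_scaleC power_mult_distrib)
      also have "\<dots> = t\<^sup>2 * ((norm Y)\<^sup>2 + (norm (hardy_coeff (A g) 0))\<^sup>2)
          + ((norm (backward_shift g))\<^sup>2 + t\<^sup>2 * (norm (backward_shift (\<Gamma> g)))\<^sup>2)"
        by (simp add: proj_const_eq norm_shift_add_const hardy_eval_zero nW shiftG norm_scaleC
            power_mult_distrib)
      also have "(norm (backward_shift (\<Gamma> g)))\<^sup>2 = (norm (\<Gamma> g))\<^sup>2 - (norm (hardy_coeff (A g) 0))\<^sup>2"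
        by (simp add: norm_backward_shift_square \<Gamma> c_def)
      also have "t\<^sup>2 * ((norm Y)\<^sup>2 + (norm (hardy_coeff (A g) 0))\<^sup>2) + ((norm (backward_shift g))\<^sup>2
            + t\<^sup>2 * ((norm (\<Gamma> g))\<^sup>2 - (norm (hardy_coeff (A g) 0))\<^sup>2))
          \<le> t\<^sup>2 * (norm Y)\<^sup>2 + ((norm g)\<^sup>2 + t\<^sup>2 * (norm (\<Gamma> g))\<^sup>2)"
        by (simp add: algebra_simps norm_backward_shift_le)
      also have "\<dots> = (norm (V x))\<^sup>2"
        by (simp add: V_def x Y_def norm_prod_def norm_scaleC nW power_mult_distrib)
      finally show "(norm (V (?M x)))\<^sup>2 \<le> (norm (V x))\<^sup>2" .
    qed simp
  qed
qed

text \<open>Duality: take the polynomial \<open>f\<close> whose coefficients are the vectors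
  \<open>u k\<close> to be estimated, and let \<open>g\<close> be \<Psi> times \<open>f\<close>.
  Moving \<open>A\<close> and the shifts across the inner product gives (norm f)^2 = cinner h g,
  which is at most norm h * C * norm f; one factor norm f cancels.\<close>

lemma square_bound_of_multiplier:
  fixes A :: "'e::chilbert_space hardy \<Rightarrow> 'e hardy"
  assumes A: "bounded_clinear A" and C: "0 \<le> C"
    and \<Psi>: "\<And>z e. z \<in> ball 0 1 \<Longrightarrow> norm (hardy_eval (cadjoint A (hardy_const e)) z) \<le> C * norm e"
      "\<And>z e. z \<in> ball 0 1 \<Longrightarrow> hardy_eval (cadjoint A (hardy_const e)) z = \<Psi> z e"
      "\<And>z. z \<in> ball 0 1 \<Longrightarrow> bounded_clinear (\<Psi> z)"
  shows "(\<Sum>k<n. (norm (hardy_coeff (A ((backward_shift ^^ k) h)) 0))\<^sup>2) \<le> (C * norm h)\<^sup>2"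
proof -
  note S = bounded_clinear_hardy_shift
  define u where "u k = hardy_coeff (A ((backward_shift ^^ k) h)) 0" for k
  define f where "f = (\<Sum>k<n. (hardy_shift ^^ k) (hardy_const (u k)))"
  define g where "g = (\<Sum>k<n. (hardy_shift ^^ k) (cadjoint A (hardy_const (u k))))"
  have coeff_pow: "hardy_coeff ((hardy_shift ^^ k) (hardy_const e)) m = (if m = k then e else 0)"
    for k m and e :: 'e
    by (induction k arbitrary: m) (auto simp: hardy_coeff_const hardy_coeff_shift split: nat.split)
  have coeff_sum: "hardy_coeff (sum F I) m = (\<Sum>i\<in>I. hardy_coeff (F i) m)"
    for F :: "nat \<Rightarrow> 'e hardy" and I m
    by (induction I rule: infinite_finite_induct) (simp_all add: hardy_coeff_ops)
  have coeff_f: "hardy_coeff f m = (if m < n then u m else 0)" for m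
    by (simp add: f_def coeff_sum coeff_pow)
  have nf: "(norm f)\<^sup>2 = (\<Sum>k<n. (norm (u k))\<^sup>2)"
    unfolding norm_hardy_square coeff_f
    by (subst suminf_finite[of "{..<n}"]) auto
  have eval_f: "hardy_eval f z = (\<Sum>k<n. z ^ k *\<^sub>C u k)"
    and eval_g: "hardy_eval g z = \<Psi> z (hardy_eval f z)" if z: "z \<in> ball 0 1" for z
  proof -
    note lin = bounded_clinear_sum[OF bounded_clinear_hardy_eval[OF z]]
    show 1: "hardy_eval f z = (\<Sum>k<n. z ^ k *\<^sub>C u k)"
      using z by (simp add: f_def lin hardy_eval_shift_funpow hardy_eval_const)
    show "hardy_eval g z = \<Psi> z (hardy_eval f z)"
      unfolding 1 bounded_clinear_sum[OF \<Psi>(3)[OF z]] bounded_clinear_scaleC[OF \<Psi>(3)[OF z]]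
      by (simp add: g_def lin hardy_eval_shift_funpow \<Psi>(2)[OF z])
  qed
  have "norm g \<le> C * norm f"
    by (rule norm_hardy_le_of_pointwise[OF C]) (metis eval_g \<Psi>(1,2))
  have adj: "cinner x ((hardy_shift ^^ k) y) = cinner ((backward_shift ^^ k) x) y"
    for x y :: "'e hardy" and k
    by (induction k arbitrary: x)
      (simp_all add: cinner_cadjoint'[OF S, symmetric] funpow_swap1[of backward_shift])
  have "complex_of_real ((norm f)\<^sup>2) = (\<Sum>k<n. cinner (u k) (u k))"
    unfolding nf by (simp add: cinner_self)
  also have "\<dots> = (\<Sum>k<n. cinner (A ((backward_shift ^^ k) h)) (hardy_const (u k)))"
    by (simp add: cinner_hardy_const hardy_eval_zero flip: u_def)
  also have "\<dots> = cinner h g"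
    by (simp add: g_def cinner_sum_right adj cinner_cadjoint[OF A])
  finally have "(norm f)\<^sup>2 = norm (cinner h g)" by (metis abs_of_nonneg norm_of_real zero_le_power2)
  also have "\<dots> \<le> norm h * norm g" by (rule norm_cinner_le)
  also have "\<dots> \<le> norm h * (C * norm f)" using \<open>norm g \<le> C * norm f\<close> by (intro mult_left_mono) auto
  finally have "norm f * norm f \<le> norm f * (C * norm h)" by (simp add: power2_eq_square mult_ac)
  then have "norm f \<le> C * norm h" using C by (cases "f = 0") auto
  then show ?thesis unfolding nf[symmetric, unfolded u_def] by (rule power_mono) simp
qed

section \<open>The symbol of a power bounded operator matrix\<close>

lemma upper_block_funpow:
  "(upper_block S X B ^^ n) (f, g) = (fst ((upper_block S X B ^^ n) (f, g)), (B ^^ n) g)"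
  by (induction n) (auto simp: upper_block_def split: prod.splits)

text \<open>Power boundedness alone gives the decomposition: the corner entries \<open>X\<^sub>n\<close> of the powers
  satisfy \<open>S\<^sup>*\<^sup>n X\<^sub>n = S\<^sup>* A\<^sub>n\<close> for the partial sums \<open>A\<^sub>n\<close> of
  \<open>\<Sum> S\<^sup>*\<^sup>k X S\<^sup>*\<^sup>k\<close>, so these are uniformly bounded; they stabilise on the kernels of
  \<open>S\<^sup>*\<^sup>d\<close> and hence converge strongly to \<open>A\<close>.  Removing the coboundary of \<open>S\<^sup>* A\<close> from
  \<open>X\<^sub>n\<close> leaves the polynomial with coefficients \<open>P\<^sub>E A S\<^sup>*\<^sup>k h\<close>.\<close>

lemma power_bounded_decomposition:
  fixes X :: "'e::chilbert_space hardy \<Rightarrow> 'e hardy"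
  assumes X: "bounded_clinear X" and K: "0 \<le> K"
    and pb: "\<And>n x. norm ((upper_block hardy_shift X backward_shift ^^ n) x) \<le> K * norm x"
  obtains A C where "bounded_clinear A" "X = (\<lambda>f. A f - backward_shift (A (backward_shift f)))"
    "0 \<le> C"
    "\<And>n h. (\<Sum>k<n. (norm (hardy_coeff (A ((backward_shift ^^ k) h)) 0))\<^sup>2) \<le> (C * norm h)\<^sup>2"
proof -
  let ?B = "backward_shift :: 'e hardy \<Rightarrow> 'e hardy" and ?S = "hardy_shift :: 'e hardy \<Rightarrow> 'e hardy"
  let ?M = "upper_block ?S X ?B"
  note S = bounded_clinear_hardy_shift and B = bounded_clinear_backward_shift
  define Xn where "Xn n g = fst ((?M ^^ n) (0, g))" for n g
  have Xn0: "Xn 0 g = 0" for g by (simp add: Xn_def)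
  have XnS: "Xn (Suc n) g = ?S (Xn n g) + X ((?B ^^ n) g)" for n g
  proof -
    have "Xn (Suc n) g = fst (?M ((?M ^^ n) (0, g)))" by (simp add: Xn_def)
    also have "(?M ^^ n) (0, g) = (Xn n g, (?B ^^ n) g)" unfolding Xn_def by (rule upper_block_funpow)
    finally show ?thesis by (simp add: upper_block_def)
  qed
  have nXn: "norm (Xn n g) \<le> K * norm g" for n g
    using norm_fst_le[of "fst ((?M ^^ n) (0, g))" "snd ((?M ^^ n) (0, g))"] pb[of n "(0, g)"]
    by (simp add: Xn_def)
  define An where "An n g = (\<Sum>k<n. (?B ^^ k) (X ((?B ^^ k) g)))" for n g
  \<comment> \<open>\<open>Xn n\<close> is the sum of \<open>S^(n-1-k) X B^k\<close> over
    \<open>k < n\<close>, and \<open>B^n\<close> reduces \<open>S^(n-1-k)\<close> to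
    \<open>B^(k+1)\<close>.\<close>
  have BX: "(?B ^^ n) (Xn n g) = ?B (An n g)" for n g
  proof (induction n)
    case (Suc n)
    have "(?B ^^ Suc n) (Xn (Suc n) g) = (?B ^^ n) (?B (Xn (Suc n) g))" by (simp add: funpow_swap1)
    also have "?B (Xn (Suc n) g) = Xn n g + ?B (X ((?B ^^ n) g))"
      by (simp add: XnS bounded_clinear_add[OF B] backward_shift_shift)
    also have "(?B ^^ n) \<dots> = ?B (An n g) + ?B ((?B ^^ n) (X ((?B ^^ n) g)))"
      by (simp add: bounded_clinear_add[OF bounded_clinear_funpow[OF B]] Suc funpow_swap1)
    also have "\<dots> = ?B (An (Suc n) g)" by (simp add: An_def bounded_clinear_add[OF B])
    finally show ?case .
  qed (simp add: Xn0 An_def bounded_clinear_zero[OF B])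
  \<comment> \<open>The previous identity controls only \<open>?B (An n g)\<close>. Splitting off
    the term \<open>k = 0\<close> leaves precisely such an expression, so \<open>An\<close> itself
    is bounded.\<close>
  have AnS: "An (Suc n) g = X g + ?B (An n (?B g))" for n g
    unfolding An_def by (subst sum.lessThan_Suc_shift)
      (simp add: bounded_clinear_sum[OF B] funpow_swap1)
  obtain L where L: "0 < L" "\<And>g. norm (X g) \<le> L * norm g" using bounded_clinear_pos_bound[OF X] by blast
  have nAn: "norm (An n g) \<le> (L + K) * norm g" for n g
  proof (cases n)
    case 0
    then show ?thesis using L(1) K by (simp add: An_def)
  next
    case (Suc m)
    have "norm (An n g) \<le> norm (X g) + norm (?B (An m (?B g)))"
      unfolding Suc AnS by (rule norm_triangle_ineq)
    also have "norm (?B (An m (?B g))) \<le> norm (Xn m (?B g))"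
      unfolding BX[symmetric] by (rule norm_backward_shift_funpow_le)
    also have "\<dots> \<le> K * norm (?B g)" by (rule nXn)
    also have "\<dots> \<le> K * norm g" by (intro mult_left_mono norm_backward_shift_le K)
    finally show ?thesis using L(2)[of g] by (simp add: algebra_simps)
  qed
  have An_lin: "bounded_clinear (An n)" for n
  proof (rule bounded_clinearI[OF _ _ nAn])
    note lin = bounded_clinearD[OF bounded_clinear_funpow[OF B]] bounded_clinearD[OF X]
    show "An n (x + y) = An n x + An n y" for x y by (simp add: An_def lin sum.distrib)
    show "An n (c *\<^sub>C x) = c *\<^sub>C An n x" for c x
      by (simp add: An_def lin linear_sum[OF bounded_linear.linear[OF bounded_linear_scaleC]])
  qed
  have "Cauchy (\<lambda>n. An n x)" for x
  proof (rule metric_CauchyI)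
    fix e :: real assume e: "e > 0"
    define e' where "e' = e / (2 * (L + K))"
    have e': "e' > 0" "2 * ((L + K) * e') = e" using e L(1) K by (simp_all add: e'_def field_simps)
    then obtain d where d: "norm ((?B ^^ d) x) < e'"
      using LIMSEQ_D[OF backward_shift_funpow_tendsto_0[of x], of e'] by auto
    \<comment> \<open>\<open>y\<close> is the tail of \<open>x\<close> and \<open>x - y\<close> its
      first \<open>d\<close> Taylor terms. The partial sums are constant on \<open>x - y\<close>
      from \<open>d\<close> on, and the uniform bound handles the small \<open>y\<close>.\<close>
    define y where "y = (?S ^^ d) ((?B ^^ d) x)"
    have ny: "norm y < e'" using d by (simp add: y_def norm_shift_funpow)
    have zero: "(?B ^^ d) (x - y) = 0"
      by (simp add: y_def bounded_clinear_diff[OF bounded_clinear_funpow[OF B]]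
          backward_shift_funpow_shift_funpow)
    have vanish: "(?B ^^ k) (x - y) = 0" if "k \<ge> d" for k
      using that by (induction k rule: dec_induct) (simp_all add: zero bounded_clinear_zero[OF B])
    have const: "An n (x - y) = An d (x - y)" if "n \<ge> d" for n
      using that
    proof (induction n rule: dec_induct)
      case (step n)
      then show ?case
        using bounded_clinear_zero[OF X] bounded_clinear_zero[OF bounded_clinear_funpow[OF B]]
        by (simp add: An_def vanish)
    qed simp
    have "dist (An k x) (An l x) < e" if "k \<ge> d" "l \<ge> d" for k l
    proof -
      have "An n x = An d (x - y) + An n y" if "n \<ge> d" for n
        using const[OF that] bounded_clinear_diff[OF An_lin, of n x y] by (simp add: diff_eq_eq)
      then have "An k x - An l x = An k y - An l y" using that by simp
      then have "dist (An k x) (An l x) \<le> norm (An k y) + norm (An l y)"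
        by (simp add: dist_norm norm_triangle_ineq4)
      also have "\<dots> \<le> 2 * ((L + K) * norm y)" using nAn[of k y] nAn[of l y] by simp
      also have "\<dots> < 2 * ((L + K) * e')" using ny L(1) K by simp
      finally show ?thesis using e' by simp
    qed
    then show "\<exists>N. \<forall>k\<ge>N. \<forall>l\<ge>N. dist (An k x) (An l x) < e" by blast
  qed
  then have "convergent (\<lambda>n. An n x)" for x by (simp add: Cauchy_convergent_iff)
  then obtain A where A: "\<And>x. (\<lambda>n. An n x) \<longlonglongrightarrow> A x" unfolding convergent_def by metis
  have bA: "bounded_clinear A"
  proof (rule bounded_clinearI[where K = "L + K"])
    show "A (x + y) = A x + A y" for x y
      using A[of "x + y"] tendsto_add[OF A[of x] A[of y]]
      by (simp add: bounded_clinear_add[OF An_lin] LIMSEQ_unique)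
    show "A (c *\<^sub>C x) = c *\<^sub>C A x" for c x
      using A[of "c *\<^sub>C x"] bounded_linear.tendsto[OF bounded_linear_scaleC A[of x], of c]
      by (simp add: bounded_clinear_scaleC[OF An_lin] LIMSEQ_unique)
    show "norm (A x) \<le> (L + K) * norm x" for x
      by (rule LIMSEQ_le_const2[OF tendsto_norm[OF A]]) (use nAn in blast)
  qed
  have AX: "A g = X g + ?B (A (?B g))" for g
  proof (rule LIMSEQ_unique[OF LIMSEQ_Suc[OF A]])
    show "(\<lambda>n. An (Suc n) g) \<longlonglongrightarrow> X g + ?B (A (?B g))"
      unfolding AnS
      by (intro tendsto_intros bounded_linear.tendsto[OF bounded_clinear_imp_linear[OF B]] A)
  qed
  define Y where "Y g = ?B (A g)" for g
  \<comment> \<open>This is the corner entry of the \<open>n\<close>-th power after conjugation by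
    the shear with \<open>Y\<close>. Each step shifts it and adds a constant, so its squared norm is
    an exact sum of squares.\<close>
  define Zn where "Zn n g = Xn n g + Y ((?B ^^ n) g) - (?S ^^ n) (Y g)" for n g
  have ZnS: "Zn (Suc n) g = ?S (Zn n g) + hardy_const (hardy_coeff (A ((?B ^^ n) g)) 0)" for n g
  proof -
    define b where "b = (?B ^^ n) g"
    have "X b + Y (?B b) = A b" using AX[of b] by (simp add: Y_def)
    also have "\<dots> = ?S (Y b) + hardy_const (hardy_coeff (A b) 0)"
      using shift_backward_shift[of "A b"] by (simp add: Y_def proj_const_eq hardy_eval_zero)
    finally show ?thesis
      by (simp add: Zn_def XnS bounded_clinear_add[OF S] bounded_clinear_diff[OF S] algebra_simps
          flip: b_def)
  qed
  have nZn: "(norm (Zn n h))\<^sup>2 = (\<Sum>k<n. (norm (hardy_coeff (A ((?B ^^ k) h)) 0))\<^sup>2)" for n h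
    by (induction n) (simp_all add: ZnS norm_shift_add_const, simp add: Zn_def Xn0)
  \<comment> \<open>\<open>K\<close> bounds the corner entry \<open>Xn\<close>, and each of the two
    \<open>Y\<close> terms of \<open>Zn\<close> costs \<open>L + K\<close>.\<close>
  define C where "C = K + 2 * (L + K)"
  have nY: "norm (Y g) \<le> (L + K) * norm g" for g
  proof -
    have "norm (A g) \<le> (L + K) * norm g"
      by (rule LIMSEQ_le_const2[OF tendsto_norm[OF A]]) (use nAn in blast)
    then show ?thesis unfolding Y_def using norm_backward_shift_le order_trans by blast
  qed
  have "norm (Zn n h) \<le> C * norm h" for n h
  proof -
    have "norm (Zn n h) \<le> norm (Xn n h) + norm (Y ((?B ^^ n) h)) + norm ((?S ^^ n) (Y h))"
      unfolding Zn_def by (intro order_trans[OF norm_triangle_ineq4] add_right_mono norm_triangle_ineq)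
    also have "norm (Y ((?B ^^ n) h)) \<le> (L + K) * norm h"
      using L(1) K by (intro order_trans[OF nY] mult_left_mono norm_backward_shift_funpow_le) auto
    also have "norm ((?S ^^ n) (Y h)) \<le> (L + K) * norm h" by (simp add: norm_shift_funpow nY)
    finally show ?thesis using nXn[of n h] by (simp add: C_def algebra_simps)
  qed
  then have "(\<Sum>k<n. (norm (hardy_coeff (A ((?B ^^ k) h)) 0))\<^sup>2) \<le> (C * norm h)\<^sup>2" for n h
    unfolding nZn[symmetric] by (rule power_mono) simp
  moreover have "X = (\<lambda>f. A f - ?B (A (?B f)))" by (rule ext, subst AX) simp
  moreover have "0 \<le> C" using K L(1) by (simp add: C_def)
  ultimately show ?thesis using bA by (intro that[of A C])
qed

section \<open>Reproducing kernels and the bound on the symbol\<close>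

text \<open>This is the Szego kernel times \<open>e\<close>; the conjugate appears because
  \<open>cinner\<close> is conjugate linear in its second argument.\<close>

lemma hardy_reproducing_kernel:
  fixes e :: "'e::chilbert_space"
  assumes z: "z \<in> ball 0 1"
  obtains k where "\<And>n. hardy_coeff k n = cnj z ^ n *\<^sub>C e" "backward_shift k = cnj z *\<^sub>C k"
    "\<And>f. cinner f k = cinner (hardy_eval f z) e"
proof -
  have "summable (\<lambda>n. (cmod z ^ 2) ^ n * (norm e)\<^sup>2)"
    using z by (intro summable_mult2 summable_geometric) (simp add: abs_square_less_1)
  then have "sq_summable (\<lambda>n. cnj z ^ n *\<^sub>C e)"
    by (simp add: sq_summable_def norm_scaleC norm_power power_mult_distrib mult.commute flip: power_mult)
  then obtain k where k: "hardy_coeff k = (\<lambda>n. cnj z ^ n *\<^sub>C e)" using hardy_exists by blast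
  have "backward_shift k = cnj z *\<^sub>C k"
    by (rule hardy_coeff_eqI) (simp add: hardy_coeff_backward_shift hardy_coeff_ops k scaleC_scaleC)
  moreover have "cinner f k = cinner (hardy_eval f z) e" for f
    using bounded_linear.suminf[OF bounded_linear_cinner_left summable_disc[OF hardy_coeff(1) z], of f e] z
    by (simp add: cinner_hardy_def k hardy_coeff(2)[of f] disc_series_def cinner_scaleC_left
        cinner_scaleC_right)
  ultimately show ?thesis using k by (intro that[of k]) auto
qed

text \<open>The reproducing kernel at \<open>z\<close> is an eigenvector of \<open>S\<^sup>*\<close>, which turns the square bound into
  a pointwise one.\<close>

lemma symbol_bound_of_square_bound:
  fixes A :: "'e::chilbert_space hardy \<Rightarrow> 'e hardy"
  assumes A: "bounded_clinear A" and C: "0 \<le> C" and z: "z \<in> ball 0 1"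
    and bound: "\<And>n h. (\<Sum>k<n. (norm (hardy_coeff (A ((backward_shift ^^ k) h)) 0))\<^sup>2) \<le> (C * norm h)\<^sup>2"
  shows "norm (hardy_eval (cadjoint A (hardy_const e)) z) \<le> C * norm e"
proof -
  define v where "v = hardy_eval (cadjoint A (hardy_const e)) z"
  \<comment> \<open>The kernel is attached to the vector \<open>v\<close> under estimation, so that
    pairing with it returns (norm v)^2.\<close>
  obtain k where k: "\<And>n. hardy_coeff k n = cnj z ^ n *\<^sub>C v" "backward_shift k = cnj z *\<^sub>C k"
    "\<And>f. cinner f k = cinner (hardy_eval f z) v"
    using hardy_reproducing_kernel[OF z, of v] by blast
  define u where "u = hardy_coeff (A k) 0"
  have pow: "(backward_shift ^^ n) k = cnj z ^ n *\<^sub>C k" for n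
    by (induction n)
      (simp_all add: k(2) bounded_clinear_scaleC[OF bounded_clinear_backward_shift] scaleC_scaleC mult.commute)
  define q where "q = (cmod z)\<^sup>2"
  have "\<bar>q\<bar> < 1" using z by (simp add: q_def abs_square_less_1)
  then have sq: "summable (\<lambda>n. q ^ n)" by (intro summable_geometric) simp
  have nq: "(norm (cnj z ^ n *\<^sub>C x))\<^sup>2 = q ^ n * (norm x)\<^sup>2" for n and x :: 'e
    by (simp add: q_def norm_scaleC norm_power power_mult_distrib mult.commute flip: power_mult)
  \<comment> \<open>Both (norm k)^2 and the square sum along the orbit of \<open>k\<close> carry
    this factor. It cancels, so the final bound does not depend on \<open>z\<close>.\<close>
  define G where "G = (\<Sum>n. q ^ n)"
  have "(\<Sum>n<1. q ^ n) \<le> G" unfolding G_def using sq by (intro sum_le_suminf) (auto simp: q_def)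
  then have G: "G > 0" by simp
  have nk: "(norm k)\<^sup>2 = G * (norm v)\<^sup>2"
    unfolding norm_hardy_square k(1) nq G_def by (rule suminf_mult2[OF sq, symmetric])
  have "(\<Sum>n<N. q ^ n * (norm u)\<^sup>2) \<le> (C * norm k)\<^sup>2" for N
    using bound[of k N]
    by (simp add: pow bounded_clinear_scaleC[OF A] hardy_coeff_ops nq flip: u_def)
  then have "(\<Sum>n. q ^ n * (norm u)\<^sup>2) \<le> (C * norm k)\<^sup>2"
    by (intro suminf_le_const summable_mult2 sq)
  then have "G * (norm u)\<^sup>2 \<le> (C * norm k)\<^sup>2"
    unfolding G_def by (simp only: suminf_mult2[OF sq])
  then have "G * (norm u)\<^sup>2 \<le> G * (C * norm v)\<^sup>2"
    by (simp add: nk power_mult_distrib mult_ac)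
  then have "(norm u)\<^sup>2 \<le> (C * norm v)\<^sup>2" using G by simp
  then have nu: "norm u \<le> C * norm v" by (rule power2_le_imp_le) (use C in simp)
  have "complex_of_real ((norm v)\<^sup>2) = cinner (cadjoint A (hardy_const e)) k"
    by (simp only: k(3) cinner_self flip: v_def)
  also have "\<dots> = cinner (hardy_const e) (A k)" by (rule cinner_cadjoint'[OF A])
  also have "\<dots> = cinner e u"
    by (subst (1 2) cinner_commute) (simp add: cinner_hardy_const hardy_eval_zero u_def)
  finally have "(norm v)\<^sup>2 = norm (cinner e u)" by (metis abs_of_nonneg norm_of_real zero_le_power2)
  also have "\<dots> \<le> norm e * norm u" by (rule norm_cinner_le)
  also have "\<dots> \<le> norm e * (C * norm v)" by (intro mult_left_mono nu) simp
  finally have "norm v * norm v \<le> norm v * (C * norm e)" by (simp add: power2_eq_square mult_ac)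
  then show ?thesis using C unfolding v_def[symmetric] by (cases "v = 0") auto
qed

section \<open>Analyticity of the symbol\<close>

text \<open>Operator-norm differentiability needs estimates uniform in \<open>e\<close>. The Taylor
  coefficients of \<open>F e\<close> are bounded by \<open>L * norm e\<close>, so everything reduces
  to scalar power series and an error linear in \<open>cmod (w - z)\<close>.\<close>

lemma hardy_family_differentiable:
  fixes F :: "'e::chilbert_space \<Rightarrow> 'e hardy"
  assumes F: "bounded_clinear F" and z: "z \<in> ball 0 1"
  shows "\<exists>D. bounded_clinear D \<and>
    ((\<lambda>w. onorm (\<lambda>e. inverse (w - z) *\<^sub>C (hardy_eval (F e) w - hardy_eval (F e) z) - D e)) \<longlongrightarrow> 0) (at z)"
proof -
  obtain L where L: "0 < L" "\<And>e. norm (F e) \<le> L * norm e" using bounded_clinear_pos_bound[OF F] by blast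
  define T where "T n e = hardy_coeff (F e) n" for n e
  have nT: "norm (T n e) \<le> L * norm e" for n e
    unfolding T_def by (rule order_trans[OF norm_hardy_coeff_le L(2)])
  have T_lin: "T n (x + y) = T n x + T n y" "T n (c *\<^sub>C x) = c *\<^sub>C T n x" for n x y c
    by (simp_all add: T_def bounded_clinear_add[OF F] bounded_clinear_scaleC[OF F] hardy_coeff_ops)
  obtain r where r: "cmod z < r" "r < 1" using dense[of "cmod z" 1] z by auto
  have r0: "0 \<le> r" using r norm_ge_zero[of z] by linarith
  \<comment> \<open>Differentiating the geometric series once and twice gives convergent majorants
    for \<open>D\<close> and for the remainder.\<close>
  have s0: "summable (\<lambda>n. (1::real) * x ^ n)" if "norm x < 1" for x :: real
    using that by (simp add: summable_geometric)
  have s1: "summable (\<lambda>n. diffs (\<lambda>_. 1::real) n * x ^ n)" if "norm x < 1" for x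
    using that by (rule termdiff_converges) (rule s0)
  have s2: "summable (\<lambda>n. diffs (diffs (\<lambda>_. 1::real)) n * r ^ n)"
    using r r0 by (intro termdiff_converges[where K = 1] s1) auto
  have "summable (\<lambda>n. real (Suc n) * cmod z ^ (Suc n - 1))"
    using s1[of "cmod z"] z by (simp add: diffs_def)
  then have sd: "summable (\<lambda>n. real n * cmod z ^ (n - 1))"
    by (subst summable_Suc_iff[symmetric])
  have "summable (\<lambda>n. real (n + 2) * real (n + 2 - Suc 0) * r ^ (n + 2 - 2))"
    using s2 by (simp add: diffs_def algebra_simps)
  then have sQ: "summable (\<lambda>n. real n * real (n - Suc 0) * r ^ (n - 2))"
    by (subst summable_iff_shift[symmetric, of _ 2])
  define Q where "Q = (\<Sum>n. real n * real (n - Suc 0) * r ^ (n - 2))"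
  have Q: "Q \<ge> 0" unfolding Q_def using r0 by (intro suminf_nonneg sQ) auto
  define D where "D e = (\<Sum>n. (of_nat n * z ^ (n - 1)) *\<^sub>C T n e)" for e
  have le_D: "norm ((of_nat n * z ^ (n - 1)) *\<^sub>C T n e) \<le> real n * cmod z ^ (n - 1) * (L * norm e)" for n e
    using nT by (auto simp: norm_scaleC norm_mult norm_power intro!: mult_left_mono)
  have sD: "summable (\<lambda>n. norm ((of_nat n * z ^ (n - 1)) *\<^sub>C T n e))" for e
    by (rule summable_comparison_test'[OF summable_mult2[OF sd]]) (use le_D in auto)
  have bD: "bounded_clinear D"
  proof (rule bounded_clinearI)
    note sD' = summable_norm_cancel[OF sD]
    show "D (x + y) = D x + D y" for x y
      unfolding D_def T_lin scaleC_add_right by (rule suminf_add[OF sD' sD', symmetric])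
    show "D (c *\<^sub>C x) = c *\<^sub>C D x" for c x
      unfolding D_def T_lin bounded_linear.suminf[OF bounded_linear_scaleC sD']
      by (simp add: scaleC_scaleC mult.commute)
    show "norm (D x) \<le> ((\<Sum>n. real n * cmod z ^ (n - 1)) * L) * norm x" for x
    proof -
      have "norm (D x) \<le> (\<Sum>n. norm ((of_nat n * z ^ (n - 1)) *\<^sub>C T n x))"
        unfolding D_def by (rule summable_norm[OF sD])
      also have "\<dots> \<le> (\<Sum>n. real n * cmod z ^ (n - 1) * (L * norm x))"
        by (intro suminf_le le_D sD summable_mult2 sd)
      also have "\<dots> = (\<Sum>n. real n * cmod z ^ (n - 1)) * (L * norm x)"
        by (rule suminf_mult2[OF sd, symmetric])
      finally show ?thesis by simp
    qed
  qed
  have ev: "(\<lambda>n. w ^ n *\<^sub>C T n e) sums hardy_eval (F e) w" if "w \<in> ball 0 1" for w e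
    using summable_sums[OF summable_disc[OF hardy_coeff(1) that]] that
    by (simp add: T_def hardy_coeff(2)[of "F e"] disc_series_def)
  have est: "norm (inverse (w - z) *\<^sub>C (hardy_eval (F e) w - hardy_eval (F e) z) - D e)
      \<le> (Q * L * cmod (w - z)) * norm e" if w: "cmod w < r" "w \<noteq> z" for w e
  proof -
    \<comment> \<open>The error of the difference quotient of the \<open>n\<close>-th power against
      its derivative at \<open>z\<close>; writing \<open>w\<close> as \<open>z + (w - z)\<close>
      fits the scalar second-order estimate.\<close>
    define c where "c n = ((z + (w - z)) ^ n - z ^ n) / (w - z) - of_nat n * z ^ (n - Suc 0)" for n
    have nc: "cmod (c n) \<le> real n * real (n - Suc 0) * r ^ (n - 2) * cmod (w - z)" for n
      unfolding c_def using lemma_termdiff3[of "w - z" z r n] w r by simp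
    have wb: "w \<in> ball 0 1" using w r by simp
    have "(\<lambda>n. inverse (w - z) *\<^sub>C (w ^ n *\<^sub>C T n e - z ^ n *\<^sub>C T n e) - (of_nat n * z ^ (n - 1)) *\<^sub>C T n e)
        sums (inverse (w - z) *\<^sub>C (hardy_eval (F e) w - hardy_eval (F e) z) - D e)"
      unfolding D_def
      by (intro sums_diff bounded_linear.sums[OF bounded_linear_scaleC] ev wb z
          summable_sums[OF summable_norm_cancel[OF sD]])
    moreover have "inverse (w - z) *\<^sub>C (w ^ n *\<^sub>C T n e - z ^ n *\<^sub>C T n e) - (of_nat n * z ^ (n - 1)) *\<^sub>C T n e
        = c n *\<^sub>C T n e" for n
    proof -
      have sub: "a *\<^sub>C x - b *\<^sub>C x = (a - b) *\<^sub>C x" for a b and x :: 'e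
        using scaleC_add_left[of "a - b" b x] by simp
      show ?thesis unfolding sub scaleC_scaleC c_def by (simp add: field_simps)
    qed
    ultimately have sums: "(\<lambda>n. c n *\<^sub>C T n e) sums
        (inverse (w - z) *\<^sub>C (hardy_eval (F e) w - hardy_eval (F e) z) - D e)" by simp
    have le: "norm (c n *\<^sub>C T n e) \<le> real n * real (n - Suc 0) * r ^ (n - 2) * (cmod (w - z) * (L * norm e))" for n
      unfolding norm_scaleC mult.assoc[symmetric, of _ "cmod (w - z)"]
      using nc nT r0 by (intro mult_mono) auto
    have sn: "summable (\<lambda>n. norm (c n *\<^sub>C T n e))"
      by (rule summable_comparison_test'[OF summable_mult2[OF sQ]]) (use le in auto)
    have "norm (\<Sum>n. c n *\<^sub>C T n e) \<le> (\<Sum>n. norm (c n *\<^sub>C T n e))" by (rule summable_norm[OF sn])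
    also have "\<dots> \<le> (\<Sum>n. real n * real (n - Suc 0) * r ^ (n - 2) * (cmod (w - z) * (L * norm e)))"
      by (intro suminf_le le sn summable_mult2 sQ)
    also have "\<dots> = Q * (cmod (w - z) * (L * norm e))"
      unfolding Q_def by (rule suminf_mult2[OF sQ, symmetric])
    finally show ?thesis using sums_unique[OF sums] by (simp add: mult_ac)
  qed
  have "((\<lambda>w. onorm (\<lambda>e. inverse (w - z) *\<^sub>C (hardy_eval (F e) w - hardy_eval (F e) z) - D e)) \<longlongrightarrow> 0) (at z)"
  proof (rule Lim_null_comparison)
    have "\<forall>\<^sub>F w in at z. w \<in> ball 0 r" using r by (intro eventually_at_in_open') auto
    moreover have "\<forall>\<^sub>F w in at z. w \<noteq> z" by (rule eventually_neq_at_within)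
    ultimately show "\<forall>\<^sub>F w in at z. norm (onorm (\<lambda>e. inverse (w - z) *\<^sub>C
        (hardy_eval (F e) w - hardy_eval (F e) z) - D e)) \<le> Q * L * cmod (w - z)"
    proof eventually_elim
      case (elim w)
      then have w: "w \<in> ball 0 1" "cmod w < r" using r by auto
      have "bounded_clinear (\<lambda>e. inverse (w - z) *\<^sub>C (hardy_eval (F e) w - hardy_eval (F e) z) - D e)"
        by (intro bounded_clinear_diff_fun bounded_clinear_scaleC_fun bD
            bounded_clinear_compose[OF bounded_clinear_hardy_eval F] w z)
      from onorm_pos_le[OF bounded_clinear_imp_linear[OF this]]
      show ?case using Q L(1) elim w by (auto intro!: onorm_bound est)
    qed
    have "((\<lambda>w. Q * L * cmod (w - z)) \<longlongrightarrow> Q * L * cmod (z - z)) (at z)" by (intro tendsto_intros)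
    then show "((\<lambda>w. Q * L * cmod (w - z)) \<longlongrightarrow> 0) (at z)" by simp
  qed
  with bD show ?thesis by blast
qed

lemma H_infinity_symbol:
  fixes A :: "'e::chilbert_space hardy \<Rightarrow> 'e hardy"
  assumes A: "bounded_clinear A" and C: "0 \<le> C"
    and bound: "\<And>n h. (\<Sum>k<n. (norm (hardy_coeff (A ((backward_shift ^^ k) h)) 0))\<^sup>2) \<le> (C * norm h)\<^sup>2"
  shows "(\<lambda>z e. hardy_eval (cadjoint A (hardy_const e)) z) \<in> H_infinity"
proof -
  have F: "bounded_clinear (\<lambda>e. cadjoint A (hardy_const e))"
    by (intro bounded_clinear_compose[OF bounded_clinear_cadjoint[OF A]] bounded_clinear_hardy_const)
  have "onorm (\<lambda>e. hardy_eval (cadjoint A (hardy_const e)) z) \<le> C" if "z \<in> ball 0 1" for z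
    by (rule onorm_bound[OF C symbol_bound_of_square_bound[OF A C that bound]])
  then show ?thesis
    unfolding H_infinity_def
    using bounded_clinear_compose[OF bounded_clinear_hardy_eval F] hardy_family_differentiable[OF F]
    by blast
qed

section \<open>The equivalences\<close>

lemma similar_to_contraction_iff_multiplier:
  fixes X :: "'e::chilbert_space hardy \<Rightarrow> 'e hardy"
  assumes X: "bounded_clinear X"
  shows "similar_to_contraction (upper_block hardy_shift X backward_shift) \<longleftrightarrow>
    (\<exists>A \<Psi>. bounded_clinear A \<and> \<Psi> \<in> H_infinity \<and>
      (\<forall>f. \<forall>z\<in>ball 0 1.
         hardy_eval (cadjoint A (proj_const f)) z = \<Psi> z (hardy_eval (proj_const f) z)) \<and>
      X = (\<lambda>f. A f - backward_shift (A (backward_shift f))))"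
    (is "?L = ?R")
proof
  assume ?L
  then obtain K where K: "0 \<le> K"
    "\<And>n x. norm ((upper_block hardy_shift X backward_shift ^^ n) x) \<le> K * norm x"
    using similar_to_contraction_power_bounded by blast
  obtain A C where A: "bounded_clinear A" "X = (\<lambda>f. A f - backward_shift (A (backward_shift f)))"
    "0 \<le> C"
    "\<And>n h. (\<Sum>k<n. (norm (hardy_coeff (A ((backward_shift ^^ k) h)) 0))\<^sup>2) \<le> (C * norm h)\<^sup>2"
    using power_bounded_decomposition[OF X K] by blast
  have "(\<lambda>z e. hardy_eval (cadjoint A (hardy_const e)) z) \<in> H_infinity"
    by (rule H_infinity_symbol[OF A(1,3,4)])
  moreover have "hardy_eval (cadjoint A (proj_const f)) z
      = (\<lambda>z e. hardy_eval (cadjoint A (hardy_const e)) z) z (hardy_eval (proj_const f) z)"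
    if "z \<in> ball 0 1" for f z
    using that by (simp add: proj_const_eq hardy_eval_const)
  ultimately show ?R using A(1,2) by blast
next
  assume ?R
  then obtain A \<Psi> where A: "bounded_clinear A" and \<Psi>: "\<Psi> \<in> H_infinity"
    and eq: "\<And>f z. z \<in> ball 0 1 \<Longrightarrow>
        hardy_eval (cadjoint A (proj_const f)) z = \<Psi> z (hardy_eval (proj_const f) z)"
    and XA: "X = (\<lambda>f. A f - backward_shift (A (backward_shift f)))"
    by blast
  obtain C where C: "\<And>z. z \<in> ball 0 1 \<Longrightarrow> onorm (\<Psi> z) \<le> C"
    and lin: "\<And>z. z \<in> ball 0 1 \<Longrightarrow> bounded_clinear (\<Psi> z)"
    using \<Psi> unfolding H_infinity_def by blast
  have sym: "hardy_eval (cadjoint A (hardy_const e)) z = \<Psi> z e" if "z \<in> ball 0 1" for z e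
    using eq[OF that, of "hardy_const e"] that by (simp add: proj_const_const hardy_eval_const)
  have C0: "0 \<le> C"
    using C[of 0] onorm_pos_le[OF bounded_clinear_imp_linear[OF lin[of 0]]] by simp
  have "norm (hardy_eval (cadjoint A (hardy_const e)) z) \<le> C * norm e" if z: "z \<in> ball 0 1" for z e
  proof -
    have "norm (\<Psi> z e) \<le> onorm (\<Psi> z) * norm e"
      by (rule onorm[OF bounded_clinear_imp_linear[OF lin[OF z]]])
    also have "\<dots> \<le> C * norm e" by (intro mult_right_mono C z) simp
    finally show ?thesis by (simp add: sym[OF z])
  qed
  from square_bound_of_multiplier[OF A C0 this sym lin] show ?L
    unfolding XA by (rule similar_to_contraction_of_square_bound[OF A C0])
qed

text \<open>Every vector is a shifted one plus a constant, so an equation between operators amounts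
  to its restrictions to the range of the shift and to the constants. There the backward shift
  respectively undoes the shift and vanishes, which simplifies the twofold product.\<close>

lemma backward_shift_equation_iff:
  fixes X :: "'e::chilbert_space hardy \<Rightarrow> 'e hardy"
  assumes X: "bounded_clinear X" and A: "bounded_clinear A"
  shows "X = (\<lambda>f. A f - backward_shift (A (backward_shift f))) \<longleftrightarrow>
    A \<circ> proj_const = X \<circ> proj_const \<and>
    X \<circ> hardy_shift = (\<lambda>f. A (hardy_shift f) - backward_shift (A f))"
    (is "?L \<longleftrightarrow> ?R")
proof
  assume ?L
  then show ?R
    by (auto simp: fun_eq_iff proj_const_eq backward_shift_const bounded_clinear_zero[OF A]
        bounded_clinear_zero[OF bounded_clinear_backward_shift] backward_shift_shift)
next
  assume ?R
  then have P: "\<And>f. X (proj_const f) = A (proj_const f)"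
    and XS: "\<And>f. X (hardy_shift f) = A (hardy_shift f) - backward_shift (A f)"
    by (simp_all add: fun_eq_iff)
  show ?L
  proof
    fix f
    have "X f = X (hardy_shift (backward_shift f)) + X (proj_const f)"
      unfolding bounded_clinear_add[OF X, symmetric] shift_backward_shift ..
    also have "\<dots> = A (hardy_shift (backward_shift f) + proj_const f) - backward_shift (A (backward_shift f))"
      by (simp add: P XS bounded_clinear_add[OF A])
    finally show "X f = A f - backward_shift (A (backward_shift f))"
      by (simp only: shift_backward_shift)
  qed
qed

theorem theorem2p2:
  fixes X :: "'e::chilbert_space hardy \<Rightarrow> 'e hardy"
  assumes "separable_space (euclidean :: 'e topology)"
    and "bounded_clinear X"
  shows "(similar_to_contraction (upper_block hardy_shift X (cadjoint hardy_shift)) \<longleftrightarrow>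
          (\<exists>A \<Psi>. bounded_clinear A \<and> \<Psi> \<in> H_infinity \<and>
            (\<forall>f. \<forall>z\<in>ball 0 1.
               hardy_eval (cadjoint A (proj_const f)) z = \<Psi> z (hardy_eval (proj_const f) z)) \<and>
            X = (\<lambda>f. A f - cadjoint hardy_shift (A (cadjoint hardy_shift f))))) \<and>
         (similar_to_contraction (upper_block hardy_shift X (cadjoint hardy_shift)) \<longleftrightarrow>
          (\<exists>A \<Psi>. bounded_clinear A \<and> \<Psi> \<in> H_infinity \<and>
            A \<circ> proj_const = X \<circ> proj_const \<and>
            (\<forall>f. \<forall>z\<in>ball 0 1.
               hardy_eval (cadjoint A (proj_const f)) z = \<Psi> z (hardy_eval (proj_const f) z)) \<and>
            X \<circ> hardy_shift = (\<lambda>f. A (hardy_shift f) - cadjoint hardy_shift (A f))))"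
  unfolding similar_to_contraction_iff_multiplier[OF assms(2)]
  using backward_shift_equation_iff[OF assms(2)] by blast

end
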